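(* Let $(Y_i, \boldsymbol{X}_i)_{i \geq 1}$ be i.i.d. random vectors with the law of a pair $(Y, \boldsymbol{X})$, and for $n \geq 2$ let $\mathcal{T} = (Y_i, \boldsymbol{X}_i)_{1 \leq i \leq n}$ be the test set of size $n = |\mathcal{T}|$. Let $\mathcal{B} = (Y_i, \boldsymbol{X}_i)_{i \in \mathfrak{B}}$ (indexed by a finite set $\mathfrak{B}$ disjoint from $\{1,2,\dots\}$, of fixed size not depending on $n$) be a set of i.i.d. random vectors that is independent of the test data $(Y_i,\boldsymbol{X}_i)_{i\ge 1}$; the pair $(Y,\boldsymbol{X})$ is independent of the test data and of $\mathcal{B}$. Let $\widehat{\mu}_\ell : \mathcal{X} \to \mathbb{R}$ be a (deterministic) measurable function and let $g_{\ell,\mathcal{B}} : \mathcal{X} \to \mathbb{R}$ be a $\sigma(\mathcal{B})$-measurable (random) function. Then the random variables $$Z_i = (Y_i - \widehat{\mu}_\ell(\boldsymbol{X}_i))\, g_{\ell,\mathcal{B}}(\boldsymbol{X}_i), \quad 1 \leq i \leq n,$$ are conditionally i.i.d. given $\mathcal{B}$. If, in addition, $$0 < \mathrm{Var}(Z_i \mid \mathcal{B}) < \infty, \quad \mathbb{P}\text{-a.s.},$$ then, under the null hypothesis that $\widehat{\mu}_\ell$ is calibrated for $(Y, \boldsymbol{X})$, $$T_n^{\mathrm{cal}} = \frac{\bar{Z}}{\sqrt{S_Z^2/n}} \stackrel{d}{\longrightarrow} \mathcal{N}(0,1) \quad \text{as } n = |\mathcal{T}| \to \infty,$$ where $$\bar{Z}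 = \frac{1}{n}\sum_{i=1}^n Z_i \quad \text{and} \quad S_Z^2 = \frac{1}{n-1}\sum_{i=1}^n (Z_i - \bar{Z})^2.$$
   Context: All random variables are defined on a probability space $(\Omega, \mathcal{F}, \mathbb{P})$. $Y$ is a real-valued square-integrable response, and $\boldsymbol{X}$ is a random vector of features taking values in a measurable feature space $\mathcal{X}$. The subscript $\ell$ refers to a fixed (non-random) set of learning data on which $\widehat{\mu}_\ell$ and $g_{\ell,\mathcal{B}}$ may depend; it plays no probabilistic role. Calibration: a measurable function $\widehat{\mu}: \mathcal{X} \to \mathbb{R}$ is calibrated for $(Y, \boldsymbol{X})$ if $\widehat{\mu}(\boldsymbol{X}) = \mathbb{E}[Y \mid \boldsymbol{X}]$, $\mathbb{P}$-a.s. That $g_{\ell,\mathcal{B}}$ is a $\sigma(\mathcal{B})$-measurable function means that it is a random function determined by $\mathcal{B}$: there is a jointly measurable real-valued map $(\boldsymbol{b}, \boldsymbol{x}) \mapsto g_{\ell,\boldsymbol{b}}(\boldsymbol{x})$, with $\boldsymbol{b}$ ranging over the possible values of $\mathcal{B}$ and $\boldsymbol{x} \in \mathcal{X}$, and $g_{\ell,\mathcal{B}}(\boldsymbol{x})$ is its value at $\boldsymbol{b} = \mathcal{B}$. $\mathrm{Var}(Z_i \mid \mathcal{B})$ is the variance of $Z_i$ under its conditional distribution given $\mathcal{B}$; its finiteness means that this conditional distribution has finite second moment. On the event $\{S_Z^2 = 0\}$, $T_n^{\mathrm{cal}}$ may be assigned an arbitrary value, e.g. $0$. *)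

theory Defs
  imports "HOL-Probability.Probability"
begin

abbreviation data_space :: "'i set \<Rightarrow> 'x measure \<Rightarrow> ('i \<Rightarrow> real \<times> 'x) measure" where
  "data_space I N \<equiv> PiM I (\<lambda>_. borel \<Otimes>\<^sub>M N)"

definition data_vec ::
  "'i set \<Rightarrow> ('i \<Rightarrow> 'a \<Rightarrow> real) \<Rightarrow> ('i \<Rightarrow> 'a \<Rightarrow> 'x) \<Rightarrow> 'a \<Rightarrow> ('i \<Rightarrow> real \<times> 'x)" where
  "data_vec I Y X \<omega> = (\<lambda>i\<in>I. (Y i \<omega>, X i \<omega>))"

abbreviation generated_algebra :: "'a measure \<Rightarrow> 'b measure \<Rightarrow> ('a \<Rightarrow> 'b) \<Rightarrow> 'a measure" where
  "generated_algebra M N X \<equiv> vimage_algebra (space M) X N"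

(* The library's indep_var forces both random variables to have the same value type. *)
definition indep_rvs ::
  "'a measure \<Rightarrow> 'b measure \<Rightarrow> ('a \<Rightarrow> 'b) \<Rightarrow> 'c measure \<Rightarrow> ('a \<Rightarrow> 'c) \<Rightarrow> bool" where
  "indep_rvs M S U T V \<longleftrightarrow>
     U \<in> measurable M S \<and> V \<in> measurable M T \<and>
     prob_space.indep_set M (sets (generated_algebra M S U)) (sets (generated_algebra M T V))"

definition calibrated ::
  "'a measure \<Rightarrow> 'x measure \<Rightarrow> ('a \<Rightarrow> real) \<Rightarrow> ('a \<Rightarrow> 'x) \<Rightarrow> ('x \<Rightarrow> real) \<Rightarrow> bool" where
  "calibrated M N Y X \<mu> \<longleftrightarrow>
     (AE \<omega> in M. \<mu> (X \<omega>) = real_cond_exp M (generated_algebra M N X) Y \<omega>)"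

definition alg_cond_prob :: "'a measure \<Rightarrow> 'a measure \<Rightarrow> ('a \<Rightarrow> bool) \<Rightarrow> 'a \<Rightarrow> real" where
  "alg_cond_prob M F P = real_cond_exp M F (indicator {\<omega> \<in> space M. P \<omega>})"

definition cond_indep_vars ::
  "'a measure \<Rightarrow> 'a measure \<Rightarrow> 'b measure \<Rightarrow> ('i \<Rightarrow> 'a \<Rightarrow> 'b) \<Rightarrow> 'i set \<Rightarrow> bool" where
  "cond_indep_vars M F N Z I \<longleftrightarrow>
     (\<forall>i\<in>I. Z i \<in> measurable M N) \<and>
     (\<forall>J A. J \<subseteq> I \<longrightarrow> finite J \<longrightarrow> (\<forall>j\<in>J. A j \<in> sets N) \<longrightarrow>
        (AE \<omega> in M. alg_cond_prob M F (\<lambda>\<omega>'. \<forall>j\<in>J. Z j \<omega>' \<in> A j) \<omega>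
                   = (\<Prod>j\<in>J. alg_cond_prob M F (\<lambda>\<omega>'. Z j \<omega>' \<in> A j) \<omega>)))"

definition cond_iid ::
  "'a measure \<Rightarrow> 'a measure \<Rightarrow> 'b measure \<Rightarrow> ('i \<Rightarrow> 'a \<Rightarrow> 'b) \<Rightarrow> 'i set \<Rightarrow> bool" where
  "cond_iid M F N Z I \<longleftrightarrow>
     cond_indep_vars M F N Z I \<and>
     (\<forall>i\<in>I. \<forall>j\<in>I. \<forall>A\<in>sets N.
        AE \<omega> in M. alg_cond_prob M F (\<lambda>\<omega>'. Z i \<omega>' \<in> A) \<omega>
                  = alg_cond_prob M F (\<lambda>\<omega>'. Z j \<omega>' \<in> A) \<omega>)"

definition is_cond_distr ::
  "'a measure \<Rightarrow> 'a measure \<Rightarrow> 'b measure \<Rightarrow> ('a \<Rightarrow> 'b) \<Rightarrow> ('a \<Rightarrow> 'b measure) \<Rightarrow> bool" where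
  "is_cond_distr M F N Z \<kappa> \<longleftrightarrow>
     \<kappa> \<in> measurable F (prob_algebra N) \<and>
     (\<forall>A\<in>sets N. AE \<omega> in M. measure (\<kappa> \<omega>) A = alg_cond_prob M F (\<lambda>\<omega>'. Z \<omega>' \<in> A) \<omega>)"

(* An arbitrary version of the regular conditional distribution; for real-valued random
   variables a version exists and is almost surely unique. *)
definition cond_distr ::
  "'a measure \<Rightarrow> 'a measure \<Rightarrow> 'b measure \<Rightarrow> ('a \<Rightarrow> 'b) \<Rightarrow> 'a \<Rightarrow> 'b measure" where
  "cond_distr M F N Z = (SOME \<kappa>. is_cond_distr M F N Z \<kappa>)"

(* Valued in [0, \<infinity>]. If the second moment of a probability measure D is infinite, the
   nonnegative integral below is \<infinity>, whatever value the (then possibly undefined) mean takes;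
   hence distr_variance D < \<infinity> holds iff D has finite second moment. *)
definition distr_variance :: "real measure \<Rightarrow> ennreal" where
  "distr_variance D = (\<integral>\<^sup>+ z. ennreal ((z - (\<integral>t. t \<partial>D))\<^sup>2) \<partial>D)"

definition cond_variance :: "'a measure \<Rightarrow> 'a measure \<Rightarrow> ('a \<Rightarrow> real) \<Rightarrow> 'a \<Rightarrow> ennreal" where
  "cond_variance M F Z \<omega> = distr_variance (cond_distr M F borel Z \<omega>)"

(* Here B is the random element and g b x the jointly measurable map, so that g (B \<omega>) is the
   realisation at \<omega> of the random function. *)
definition weighted_residual ::
  "('x \<Rightarrow> real) \<Rightarrow> ('c \<Rightarrow> 'x \<Rightarrow> real) \<Rightarrow> ('a \<Rightarrow> 'c) \<Rightarrow> ('i \<Rightarrow> 'a \<Rightarrow> real) \<Rightarrow> ('i \<Rightarrow> 'a \<Rightarrow> 'x)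
     \<Rightarrow> 'i \<Rightarrow> 'a \<Rightarrow> real" where
  "weighted_residual \<mu> g B Y X i \<omega> = (Y i \<omega> - \<mu> (X i \<omega>)) * g (B \<omega>) (X i \<omega>)"

definition sample_mean :: "(nat \<Rightarrow> 'a \<Rightarrow> real) \<Rightarrow> nat \<Rightarrow> 'a \<Rightarrow> real" where
  "sample_mean Z n \<omega> = (\<Sum>i=1..n. Z i \<omega>) / real n"

definition sample_variance :: "(nat \<Rightarrow> 'a \<Rightarrow> real) \<Rightarrow> nat \<Rightarrow> 'a \<Rightarrow> real" where
  "sample_variance Z n \<omega> = (\<Sum>i=1..n. (Z i \<omega> - sample_mean Z n \<omega>)\<^sup>2) / (real n - 1)"

(* The parameter c is the arbitrary value assigned on the event that the sample variance
   vanishes. For n < 2, where the statistic is undefined, the value is irrelevant. *)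
definition cal_statistic :: "real \<Rightarrow> (nat \<Rightarrow> 'a \<Rightarrow> real) \<Rightarrow> nat \<Rightarrow> 'a \<Rightarrow> real" where
  "cal_statistic c Z n \<omega> =
     (if sample_variance Z n \<omega> = 0 then c
      else sample_mean Z n \<omega> / sqrt (sample_variance Z n \<omega> / real n))"

end

theory Submission
  imports Defs
begin

text \<open>Since the batch is independent of the test data, conditioning on it amounts to freezing its
  value \<open>b\<close>: the frozen variables \<open>(Y\<^sub>i - \<mu> X\<^sub>i) g\<^sub>b X\<^sub>i\<close> are i.i.d., and their common law is a
  version of the conditional distribution of \<open>Z\<^sub>i\<close>. Calibration makes \<open>Y - \<mu> X\<close> orthogonal to every
  function of \<open>X\<close>, so for almost every \<open>b\<close> this law is centred with positive finite variance, and the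
  frozen statistic is asymptotically standard normal: the central limit theorem handles the sample
  mean, and the sample variance is consistent by a law of large numbers in \<open>L\<^sup>1\<close>, proved by
  truncation. The limit does not depend on \<open>b\<close>, so dominated convergence of the distribution
  functions removes the conditioning.\<close>

subsection \<open>A law of large numbers in mean\<close>

text \<open>Expanding the square gives a double sum whose off-diagonal terms vanish by independence
  and zero mean; the \<open>n\<close> diagonal terms contribute \<open>v\<close> each.\<close>

lemma (in prob_space) indep_vars_expectation_sum_square:
  fixes V :: "nat \<Rightarrow> 'a \<Rightarrow> real"
  assumes indep: "indep_vars (\<lambda>_. borel) V UNIV"
    and sq: "\<And>i. integrable M (\<lambda>\<omega>. (V i \<omega>)\<^sup>2)"
    and mean: "\<And>i. expectation (V i) = 0"
    and var: "\<And>i. expectation (\<lambda>\<omega>. (V i \<omega>)\<^sup>2) = v"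
  shows "integrable M (\<lambda>\<omega>. (\<Sum>i<n. V i \<omega>)\<^sup>2)"
    and "expectation (\<lambda>\<omega>. (\<Sum>i<n. V i \<omega>)\<^sup>2) = real n * v"
proof -
  have rv[measurable]: "V i \<in> borel_measurable M" for i
    using indep by (auto simp: indep_vars_def)
  have int: "integrable M (V i)" for i
    by (rule square_integrable_imp_integrable[OF rv sq])
  have "integrable M (\<lambda>\<omega>. V i \<omega> * V j \<omega>) \<and>
      expectation (\<lambda>\<omega>. V i \<omega> * V j \<omega>) = (if i = j then v else 0)" for i j
  proof (cases "i = j")
    case True
    then show ?thesis using sq[of j] var[of j] by (simp add: power2_eq_square)
  next
    case False
    have "indep_vars (\<lambda>_. borel) V {i, j}" by (rule indep_vars_subset[OF indep]) simp
    from indep_vars_integrable[OF _ this int] indep_vars_lebesgue_integral[OF _ this int] False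
    show ?thesis by (simp add: mean)
  qed
  then have prods: "integrable M (\<lambda>\<omega>. V i \<omega> * V j \<omega>)"
      "expectation (\<lambda>\<omega>. V i \<omega> * V j \<omega>) = (if i = j then v else 0)" for i j
    by auto
  have eq: "(\<lambda>\<omega>. (\<Sum>i<n. V i \<omega>)\<^sup>2) = (\<lambda>\<omega>. \<Sum>i<n. \<Sum>j<n. V i \<omega> * V j \<omega>)"
    by (simp add: power2_eq_square sum_product)
  show "integrable M (\<lambda>\<omega>. (\<Sum>i<n. V i \<omega>)\<^sup>2)"
    unfolding eq using prods by (intro Bochner_Integration.integrable_sum) auto
  show "expectation (\<lambda>\<omega>. (\<Sum>i<n. V i \<omega>)\<^sup>2) = real n * v"
    unfolding eq using prods by (simp add: Bochner_Integration.integral_sum)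
qed

text \<open>Integrates the pointwise bound that follows from
  \<open>(e - \<bar>W \<omega>\<bar>)\<^sup>2 \<ge> 0\<close>. The free parameter \<open>e\<close>
  converts a small second moment into a small first absolute moment.\<close>

lemma (in prob_space) expectation_abs_le_square:
  fixes W :: "'a \<Rightarrow> real"
  assumes "e > 0" and [measurable]: "W \<in> borel_measurable M" and sq: "integrable M (\<lambda>\<omega>. (W \<omega>)\<^sup>2)"
  shows "expectation (\<lambda>\<omega>. \<bar>W \<omega>\<bar>) \<le> e + expectation (\<lambda>\<omega>. (W \<omega>)\<^sup>2) / e"
proof -
  have int: "integrable M W" by (rule square_integrable_imp_integrable[OF _ sq]) simp
  have "expectation (\<lambda>\<omega>. \<bar>W \<omega>\<bar>) \<le> expectation (\<lambda>\<omega>. e + (W \<omega>)\<^sup>2 / e)"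
  proof (rule integral_mono)
    fix \<omega>
    have "0 \<le> (e - \<bar>W \<omega>\<bar>)\<^sup>2" by simp
    then have "2 * e * \<bar>W \<omega>\<bar> \<le> e\<^sup>2 + (W \<omega>)\<^sup>2" by (simp add: power2_diff)
    moreover have "0 \<le> e * \<bar>W \<omega>\<bar>" using \<open>e > 0\<close> by simp
    ultimately have "e * \<bar>W \<omega>\<bar> \<le> e\<^sup>2 + (W \<omega>)\<^sup>2" by linarith
    then show "\<bar>W \<omega>\<bar> \<le> e + (W \<omega>)\<^sup>2 / e"
      using \<open>e > 0\<close> by (simp add: field_simps power2_eq_square)
  qed (use int sq in auto)
  also have "\<dots> = e + expectation (\<lambda>\<omega>. (W \<omega>)\<^sup>2) / e"
    using sq by (simp add: prob_space)
  finally show ?thesis .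
qed

text \<open>Truncation at a level \<open>k\<close> splits each variable: averages of the bounded
  part have variance of order 1/n, and the discarded part costs \<open>d k\<close> in mean,
  uniformly in n. Only a first moment enters, so the law applies to squares of variables without a
  fourth moment.\<close>

theorem (in prob_space) weak_law_of_large_numbers_L1:
  fixes U :: "nat \<Rightarrow> 'a \<Rightarrow> real" and \<nu> :: "real measure"
  assumes indep: "indep_vars (\<lambda>_. borel) U UNIV"
    and distr: "\<And>i. distr M borel (U i) = \<nu>"
    and int\<nu>: "integrable \<nu> (\<lambda>x. x)"
  shows "(\<lambda>n. expectation (\<lambda>\<omega>. \<bar>(\<Sum>i<n. U i \<omega>) / real n - (\<integral>x. x \<partial>\<nu>)\<bar>)) \<longlonglongrightarrow> 0"
proof -
  define m where "m = (\<integral>x. x \<partial>\<nu>)"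
  define T where "T K x = max (- K) (min K x)" for K x :: real
  define d where "d k = (\<integral>x. \<bar>x - T (real k) x\<bar> \<partial>\<nu>)" for k :: nat
  have rv[measurable]: "U i \<in> borel_measurable M" for i
    using indep by (auto simp: indep_vars_def)
  have [measurable]: "T K \<in> borel_measurable borel" for K unfolding T_def by measurable
  have sets\<nu>[measurable_cong, simp]: "sets \<nu> = sets borel" using distr[of 0] by auto
  interpret \<nu>: prob_space \<nu> using prob_space_distr[OF rv[of 0]] distr by simp
  have intU: "integrable M (U i)" for i
    using int\<nu> unfolding distr[of i, symmetric] by (simp add: integrable_distr_eq)
  have E: "expectation (\<lambda>\<omega>. f (U i \<omega>)) = (\<integral>x. f x \<partial>\<nu>)" if "f \<in> borel_measurable borel"
    for f :: "real \<Rightarrow> real" and i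
    using integral_distr[OF rv[of i] that] distr by simp
  have T_bound: "\<bar>T (real k) x\<bar> \<le> real k" for k x by (auto simp: T_def)
  have intT\<nu>: "integrable \<nu> (T (real k))" for k
    by (rule \<nu>.integrable_const_bound[where B="real k"]) (auto simp: T_bound)
  have intTU: "integrable M (\<lambda>\<omega>. T (real k) (U i \<omega>))" for i k
    by (rule integrable_const_bound[where B="real k"]) (auto simp: T_bound)
  \<comment> \<open>At each point clipping is inactive once the level exceeds
    \<open>\<bar>x\<bar>\<close>, and the clipping error is dominated by
    \<open>\<bar>x\<bar>\<close>.\<close>
  have d_lim: "d \<longlonglongrightarrow> 0"
  proof -
    have "(\<lambda>k. \<integral>x. \<bar>x - T (real k) x\<bar> \<partial>\<nu>) \<longlonglongrightarrow> (\<integral>x. 0 \<partial>\<nu>)"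
    proof (rule integral_dominated_convergence[where w="\<lambda>x. \<bar>x\<bar>"])
      show "AE x in \<nu>. (\<lambda>k. \<bar>x - T (real k) x\<bar>) \<longlonglongrightarrow> 0"
      proof (rule AE_I2, rule tendsto_eventually)
        fix x :: real
        obtain k0 :: nat where "\<bar>x\<bar> \<le> real k0" using real_arch_simple by blast
        then show "\<forall>\<^sub>F k in sequentially. \<bar>x - T (real k) x\<bar> = 0"
          by (intro eventually_sequentiallyI[of k0]) (auto simp: T_def)
      qed
      show "AE x in \<nu>. norm \<bar>x - T (real k) x\<bar> \<le> \<bar>x\<bar>" for k by (auto simp: T_def)
      show "integrable \<nu> (\<lambda>x. \<bar>x\<bar>)" using int\<nu> by (rule integrable_abs)
    qed measurable
    then show ?thesis by (simp add: d_def[abs_def])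
  qed
  show ?thesis unfolding m_def[symmetric]
  proof (rule LIMSEQ_I)
    fix r :: real assume "r > 0"
    \<comment> \<open>The final estimate has four terms of size at most \<open>e\<close>: three from
      \<open>main\<close> and one from taking n large. The fifth share leaves room for
      strictness.\<close>
    define e where "e = r / 5"
    have "e > 0" using \<open>r > 0\<close> by (simp add: e_def)
    \<comment> \<open>The level is fixed before n, so the variance \<open>v\<close> of the truncated
      variables is a constant.\<close>
    obtain k where k: "d k < e"
      using order_tendstoD(2)[OF d_lim \<open>e > 0\<close>] by (auto simp: eventually_sequentially)
    define mk where "mk = (\<integral>x. T (real k) x \<partial>\<nu>)"
    define V where "V i \<omega> = T (real k) (U i \<omega>) - mk" for i \<omega>
    have [measurable]: "V i \<in> borel_measurable M" for i unfolding V_def by measurable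
    have mk_bound: "\<bar>mk\<bar> \<le> real k"
    proof -
      have "\<bar>mk\<bar> \<le> (\<integral>x. \<bar>T (real k) x\<bar> \<partial>\<nu>)" unfolding mk_def by (rule integral_abs_bound)
      also have "\<dots> \<le> real k"
        using intT\<nu>[of k] T_bound by (intro \<nu>.integral_le_const) auto
      finally show ?thesis .
    qed
    have mk_m: "\<bar>mk - m\<bar> \<le> d k"
    proof -
      have "mk - m = (\<integral>x. T (real k) x - x \<partial>\<nu>)" unfolding mk_def m_def using intT\<nu> int\<nu> by simp
      also have "\<bar>\<dots>\<bar> \<le> (\<integral>x. \<bar>T (real k) x - x\<bar> \<partial>\<nu>)" by (rule integral_abs_bound)
      also have "\<dots> = d k" by (simp add: d_def abs_minus_commute)
      finally show ?thesis .
    qed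
    have V_bound: "\<bar>V i \<omega>\<bar> \<le> 2 * real k" for i \<omega>
      unfolding V_def using T_bound[of k "U i \<omega>"] mk_bound by linarith
    have V_indep: "indep_vars (\<lambda>_. borel) V UNIV"
      using indep_vars_compose2[OF indep, of "\<lambda>_ x. T (real k) x - mk" "\<lambda>_. borel"]
      by (simp add: V_def[abs_def])
    have V_sq: "integrable M (\<lambda>\<omega>. (V i \<omega>)\<^sup>2)" for i
      using power_mono[OF V_bound[of i] abs_ge_zero, where n=2]
      by (intro integrable_const_bound[where B="(2 * real k)\<^sup>2"]) auto
    have V_mean: "expectation (V i) = 0" for i
      unfolding V_def using intTU E[of "T (real k)" i] by (simp add: prob_space mk_def)
    define v where "v = (\<integral>x. (T (real k) x - mk)\<^sup>2 \<partial>\<nu>)"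
    have V_var: "expectation (\<lambda>\<omega>. (V i \<omega>)\<^sup>2) = v" for i
      unfolding V_def v_def by (rule E) measurable
    have v_nn: "0 \<le> v" unfolding v_def by simp
    note V2 = indep_vars_expectation_sum_square[OF V_indep V_sq V_mean V_var]
    \<comment> \<open>One \<open>e\<close> comes from the second-moment bound on the centred
      truncated average \<open>W\<close>, one from the truncation error of the data and one from
      that of the mean.\<close>
    have main: "expectation (\<lambda>\<omega>. \<bar>(\<Sum>i<n. U i \<omega>) / real n - m\<bar>) \<le> 3 * e + v / e / real n"
      if "n > 0" for n :: nat
    proof -
      define W where "W \<omega> = (\<Sum>i<n. V i \<omega>) / real n" for \<omega>
      have [measurable]: "W \<in> borel_measurable M" unfolding W_def by measurable
      have W2: "integrable M (\<lambda>\<omega>. (W \<omega>)\<^sup>2)" "expectation (\<lambda>\<omega>. (W \<omega>)\<^sup>2) = v / real n"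
        unfolding W_def power_divide using V2[of n] that by (auto simp: power2_eq_square)
      have intW: "integrable M W" by (rule square_integrable_imp_integrable[OF _ W2(1)]) simp
      define R where "R \<omega> = (\<Sum>i<n. \<bar>U i \<omega> - T (real k) (U i \<omega>)\<bar>) / real n" for \<omega>
      have ER: "expectation R = d k" "integrable M R"
      proof -
        have "expectation (\<lambda>\<omega>. \<bar>U i \<omega> - T (real k) (U i \<omega>)\<bar>) = d k" for i
          unfolding d_def by (rule E) measurable
        then show "expectation R = d k" "integrable M R"
          unfolding R_def using intU intTU that by (auto simp: Bochner_Integration.integral_sum)
      qed
      have "\<bar>(\<Sum>i<n. U i \<omega>) / real n - m\<bar> \<le> \<bar>W \<omega>\<bar> + R \<omega> + \<bar>mk - m\<bar>" for \<omega>
      proof -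
        have "(\<Sum>i<n. U i \<omega>) / real n - m
            = W \<omega> + (\<Sum>i<n. U i \<omega> - T (real k) (U i \<omega>)) / real n + (mk - m)"
          unfolding W_def V_def using that by (simp add: sum_subtractf field_simps)
        moreover have "\<bar>(\<Sum>i<n. U i \<omega> - T (real k) (U i \<omega>)) / real n\<bar> \<le> R \<omega>"
          unfolding R_def by (simp add: divide_right_mono)
        ultimately show ?thesis by linarith
      qed
      then have "expectation (\<lambda>\<omega>. \<bar>(\<Sum>i<n. U i \<omega>) / real n - m\<bar>)
          \<le> expectation (\<lambda>\<omega>. \<bar>W \<omega>\<bar> + R \<omega> + \<bar>mk - m\<bar>)"
        using intU intW ER by (intro integral_mono) auto
      also have "\<dots> = expectation (\<lambda>\<omega>. \<bar>W \<omega>\<bar>) + d k + \<bar>mk - m\<bar>"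
        using intW ER by (simp add: prob_space)
      also have "\<dots> \<le> (e + v / real n / e) + e + e"
        using expectation_abs_le_square[OF \<open>e > 0\<close> _ W2(1)] W2(2) k mk_m by simp
      finally show ?thesis by (simp add: field_simps)
    qed
    have "(\<lambda>n. v / e / real n) \<longlonglongrightarrow> 0" by (rule lim_const_over_n)
    then have "\<forall>\<^sub>F n in sequentially. v / e / real n < e"
      using \<open>e > 0\<close> by (rule order_tendstoD)
    then obtain n0 where n0: "\<And>n. n \<ge> n0 \<Longrightarrow> v / e / real n < e"
      by (auto simp: eventually_sequentially)
    have "norm (expectation (\<lambda>\<omega>. \<bar>(\<Sum>i<n. U i \<omega>) / real n - m\<bar>) - 0) < r" if "n \<ge> max 1 n0" for n
    proof -
      have "n \<ge> n0" "n > 0" using that by auto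
      then have "expectation (\<lambda>\<omega>. \<bar>(\<Sum>i<n. U i \<omega>) / real n - m\<bar>) < r"
        using main[of n] n0[of n] \<open>e > 0\<close> e_def by linarith
      then show ?thesis by simp
    qed
    then show "\<exists>no. \<forall>n\<ge>no. norm (expectation (\<lambda>\<omega>. \<bar>(\<Sum>i<n. U i \<omega>) / real n - m\<bar>) - 0) < r"
      by blast
  qed
qed

subsection \<open>Asymptotic normality of the studentised mean\<close>

text \<open>Factoring out \<open>iexp b\<close>, which has modulus 1, leaves the Taylor estimate of
  order zero at \<open>a - b\<close>.\<close>

lemma norm_iexp_diff_le: "cmod (iexp a - iexp b) \<le> \<bar>a - b\<bar>"
proof -
  have "iexp a - iexp b = iexp b * (iexp (a - b) - 1)"
    by (simp add: algebra_simps flip: exp_add)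
  then have "cmod (iexp a - iexp b) = cmod (iexp (a - b) - 1)" by (simp add: norm_mult)
  also have "\<dots> \<le> \<bar>a - b\<bar>" using iexp_approx1[of "a - b" 0] by simp
  finally show ?thesis .
qed

text \<open>In \<open>y - 1 = (sqrt y - 1) * (sqrt y + 1)\<close> the second factor is at least
  1.\<close>

lemma abs_sqrt_minus_one_le:
  assumes "y \<ge> 0"
  shows "\<bar>sqrt y - 1\<bar> \<le> \<bar>y - 1\<bar>"
proof -
  have "y - 1 = (sqrt y - 1) * (sqrt y + 1)" using assms by (simp add: algebra_simps)
  then have "\<bar>y - 1\<bar> = \<bar>sqrt y - 1\<bar> * (sqrt y + 1)" using assms by (simp add: abs_mult)
  moreover have "\<bar>sqrt y - 1\<bar> * 1 \<le> \<bar>sqrt y - 1\<bar> * (sqrt y + 1)"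
    using assms by (intro mult_left_mono) auto
  ultimately show ?thesis by simp
qed

section \<open>Sample variance and studentised mean: measurability and algebra\<close>

lemma borel_measurable_sample_variance:
  assumes "\<And>i. i \<ge> 1 \<Longrightarrow> Z i \<in> borel_measurable M"
  shows "sample_variance Z n \<in> borel_measurable M" "sample_mean Z n \<in> borel_measurable M"
proof -
  have [measurable]: "sample_mean Z n \<in> borel_measurable M" for n
    unfolding sample_mean_def[abs_def] using assms by (intro borel_measurable_divide borel_measurable_sum) auto
  then show "sample_mean Z n \<in> borel_measurable M" .
  show "sample_variance Z n \<in> borel_measurable M"
    unfolding sample_variance_def[abs_def] using assms
    by (intro borel_measurable_divide borel_measurable_sum borel_measurable_power borel_measurable_diff) auto
qed

lemma borel_measurable_cal_statistic:
  assumes "\<And>i. i \<ge> 1 \<Longrightarrow> Z i \<in> borel_measurable M"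
  shows "cal_statistic c Z n \<in> borel_measurable M"
proof -
  note [measurable] = borel_measurable_sample_variance[OF assms]
  show ?thesis unfolding cal_statistic_def[abs_def] by measurable
qed

text \<open>Separates the sum of squares, governed by a law of large numbers, from the squared sum,
  governed by its second moment. For \<open>n = 1\<close> both sides are 0, as division by zero
  yields 0.\<close>

lemma sample_variance_eq:
  assumes "n > 0"
  shows "sample_variance Z n \<omega> =
    ((\<Sum>i=1..n. (Z i \<omega>)\<^sup>2) - (\<Sum>i=1..n. Z i \<omega>)\<^sup>2 / real n) / (real n - 1)"
proof -
  define m where "m = sample_mean Z n \<omega>"
  have S: "(\<Sum>i=1..n. Z i \<omega>) = real n * m" using assms by (simp add: m_def sample_mean_def)
  have "(\<Sum>i=1..n. (Z i \<omega> - m)\<^sup>2)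
      = (\<Sum>i=1..n. (Z i \<omega>)\<^sup>2) - 2 * m * (\<Sum>i=1..n. Z i \<omega>) + real n * m\<^sup>2"
    by (simp add: power2_diff sum.distrib sum_subtractf sum_distrib_left algebra_simps)
  then show ?thesis
    unfolding sample_variance_def m_def[symmetric] S using assms
    by (simp add: power2_eq_square algebra_simps)
qed

text \<open>Separates the sum standardised by the true variance \<open>v\<close>, to which the
  central limit theorem applies, from a correction factor that should approach 1.\<close>

lemma cal_statistic_eq:
  assumes "n > 0" "v > 0" "sample_variance Z n \<omega> > 0"
  shows "cal_statistic c Z n \<omega> =
    (\<Sum>i=1..n. Z i \<omega>) / sqrt (real n * v) * sqrt (v / sample_variance Z n \<omega>)"
  using assms real_sqrt_mult_self[of "real n"]
  by (simp add: cal_statistic_def sample_mean_def real_sqrt_divide real_sqrt_mult field_simps)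

text \<open>A quantitative form of Slutsky's theorem: the first term covers the event on which the sample
  variance is within \<open>\<delta> v\<close> of \<open>v\<close>; off this event the second term exceeds the trivial bound 2.\<close>

lemma cal_statistic_iexp_bound:
  fixes t :: real and Z :: "nat \<Rightarrow> 'a \<Rightarrow> real" and \<omega> :: 'a
  assumes n: "n > 0" and v: "v > 0" and \<delta>: "0 < \<delta>" "\<delta> \<le> 1 / 2"
  defines "b \<equiv> (\<Sum>i=1..n. Z i \<omega>) / sqrt (real n * v)"
  shows "cmod (iexp (t * cal_statistic c Z n \<omega>) - iexp (t * b))
    \<le> 2 * \<delta> * \<bar>t\<bar> * \<bar>b\<bar> + 2 * \<bar>sample_variance Z n \<omega> - v\<bar> / (\<delta> * v)"
proof -
  let ?V = "sample_variance Z n \<omega>" and ?a = "cal_statistic c Z n \<omega>"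
  show ?thesis
  proof (cases "\<bar>?V - v\<bar> \<le> \<delta> * v")
    case True
    \<comment> \<open>With \<open>\<delta> \<le> 1 / 2\<close> the sample variance stays above
      \<open>v / 2\<close>: the default \<open>c\<close> is not taken, and dividing by the sample
      variance costs only a factor 2.\<close>
    have "\<delta> * v \<le> 1 / 2 * v" using \<delta> v by (intro mult_right_mono) auto
    then have V: "?V \<ge> v / 2" "?V > 0" using True v by linarith+
    have "\<bar>sqrt (v / ?V) - 1\<bar> \<le> \<bar>v / ?V - 1\<bar>"
      using V v by (intro abs_sqrt_minus_one_le) auto
    also have "v / ?V - 1 = (v - ?V) / ?V" using V by (simp add: field_simps)
    also have "\<bar>(v - ?V) / ?V\<bar> \<le> (\<delta> * v) / (v / 2)"
      using True V v unfolding abs_divide by (intro frac_le) auto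
    finally have "\<bar>sqrt (v / ?V) - 1\<bar> \<le> 2 * \<delta>" using v by simp
    moreover have "?a - b = b * (sqrt (v / ?V) - 1)"
      using cal_statistic_eq[OF n v V(2), folded b_def] by (simp add: right_diff_distrib)
    ultimately have "\<bar>?a - b\<bar> \<le> \<bar>b\<bar> * (2 * \<delta>)" by (simp add: abs_mult mult_left_mono)
    then have "\<bar>t\<bar> * \<bar>?a - b\<bar> \<le> \<bar>t\<bar> * (\<bar>b\<bar> * (2 * \<delta>))" by (rule mult_left_mono) simp
    moreover have "\<bar>t * ?a - t * b\<bar> = \<bar>t\<bar> * \<bar>?a - b\<bar>"
      by (simp add: abs_mult flip: right_diff_distrib)
    moreover have "0 \<le> 2 * \<bar>?V - v\<bar> / (\<delta> * v)" using \<delta> v by simp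
    ultimately show ?thesis
      using norm_iexp_diff_le[of "t * ?a" "t * b"] by (simp add: algebra_simps)
  next
    \<comment> \<open>Here the sample variance may vanish and the statistic may equal
      \<open>c\<close>; the bound by 2 holds whatever that value is.\<close>
    case False
    then have "2 \<le> 2 * \<bar>?V - v\<bar> / (\<delta> * v)" using \<delta> v by (simp add: field_simps)
    moreover have "cmod (iexp (t * ?a) - iexp (t * b)) \<le> 2"
      using norm_triangle_ineq4[of "iexp (t * ?a)" "iexp (t * b)"] by simp
    moreover have "0 \<le> 2 * \<delta> * \<bar>t\<bar> * \<bar>b\<bar>" using \<delta> by simp
    ultimately show ?thesis by linarith
  qed
qed


lemma (in prob_space) indep_vars_reindex:
  assumes inj: "inj_on f I" and indep: "indep_vars M' X (f ` I)"
  shows "indep_vars (\<lambda>i. M' (f i)) (\<lambda>i. X (f i)) I"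
  unfolding indep_vars_def2
proof (intro conjI ballI indep_setsI)
  have sets: "indep_sets (\<lambda>i. {X i -` A \<inter> space M |A. A \<in> sets (M' i)}) (f ` I)"
    and rv: "\<forall>i\<in>f ` I. random_variable (M' i) (X i)"
    using indep by (auto simp: indep_vars_def2)
  show "random_variable (M' (f i)) (X (f i))" if "i \<in> I" for i using rv that by simp
  then show "{X (f i) -` A \<inter> space M |A. A \<in> sets (M' (f i))} \<subseteq> events" if "i \<in> I" for i
    using that by (auto dest: measurable_sets)
  fix A J
  assume J: "J \<noteq> {}" "J \<subseteq> I" "finite J"
    and A: "\<forall>j\<in>J. A j \<in> {X (f j) -` A \<inter> space M |A. A \<in> sets (M' (f j))}"
  have inv: "inv_into I f (f j) = j" if "j \<in> J" for j using inj that J by (auto intro: inv_into_f_f)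
  have injJ: "inj_on f J" using inj J(2) by (rule inj_on_subset)
  have "prob (\<Inter>k\<in>f ` J. A (inv_into I f k)) = (\<Prod>k\<in>f ` J. prob (A (inv_into I f k)))"
    by (rule indep_setsD[OF sets]) (use J A inv in auto)
  then show "prob (\<Inter>j\<in>J. A j) = (\<Prod>j\<in>J. prob (A j))"
    using inv by (simp add: prod.reindex[OF injJ])
qed

text \<open>The statistic is compared with the sum \<open>b n\<close> standardised by the true
  variance. The classical central limit theorem covers \<open>b n\<close>, and the two
  characteristic functions merge because the sample variance converges in mean; Levy's continuity
  theorem concludes.\<close>

theorem (in prob_space) cal_statistic_central_limit:
  fixes Z :: "nat \<Rightarrow> 'a \<Rightarrow> real" and \<nu> :: "real measure"
  assumes indep: "indep_vars (\<lambda>_. borel) Z {1..}"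
    and distr: "\<And>i. i \<ge> 1 \<Longrightarrow> distr M borel (Z i) = \<nu>"
    and sq\<nu>: "integrable \<nu> (\<lambda>x. x\<^sup>2)"
    and mean\<nu>: "(\<integral>x. x \<partial>\<nu>) = 0"
    and pos\<nu>: "0 < (\<integral>x. x\<^sup>2 \<partial>\<nu>)"
  shows "weak_conv_m (\<lambda>n. distr M borel (cal_statistic c Z n)) std_normal_distribution"
proof -
  define v where "v = (\<integral>x. x\<^sup>2 \<partial>\<nu>)"
  have v: "v > 0" using pos\<nu> by (simp add: v_def)
  \<comment> \<open>The data start at index 1, whereas the limit theorems used are stated for
    sequences starting at 0.\<close>
  define U where "U i = Z (Suc i)" for i
  have U_indep: "indep_vars (\<lambda>_. borel) U UNIV"
  proof -
    have "indep_vars (\<lambda>_. borel) Z (range Suc)"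
      by (rule indep_vars_subset[OF indep]) auto
    from indep_vars_reindex[OF _ this] show ?thesis by (simp add: U_def[abs_def])
  qed
  have rv[measurable]: "U i \<in> borel_measurable M" for i
    using U_indep by (auto simp: indep_vars_def)
  have Zrv: "Z i \<in> borel_measurable M" if "i \<ge> 1" for i
    using indep that by (auto simp: indep_vars_def)
  have U_distr: "distr M borel (U i) = \<nu>" for i unfolding U_def by (rule distr) simp
  have sets\<nu>[measurable_cong, simp]: "sets \<nu> = sets borel" using U_distr[of 0] by auto
  have E: "expectation (\<lambda>\<omega>. f (U i \<omega>)) = (\<integral>x. f x \<partial>\<nu>)" if "f \<in> borel_measurable borel"
    for f :: "real \<Rightarrow> real" and i
    using integral_distr[OF rv[of i] that] U_distr by simp
  have U_sq: "integrable M (\<lambda>\<omega>. (U i \<omega>)\<^sup>2)" for i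
    using sq\<nu> unfolding U_distr[of i, symmetric] by (simp add: integrable_distr_eq)
  have U_mean: "expectation (U i) = 0" for i using E[of "\<lambda>x. x" i] mean\<nu> by simp
  have U_var: "expectation (\<lambda>\<omega>. (U i \<omega>)\<^sup>2) = v" for i using E[of "\<lambda>x. x\<^sup>2" i] by (simp add: v_def)
  define S where "S n \<omega> = (\<Sum>i<n. U i \<omega>)" for n \<omega>
  have [measurable]: "S n \<in> borel_measurable M" for n unfolding S_def by measurable
  have sum_shift: "(\<Sum>i=1..n. f (Z i \<omega>)) = (\<Sum>i<n. f (U i \<omega>))" for f :: "real \<Rightarrow> real" and n \<omega>
    unfolding U_def by (simp add: sum.atLeast1_atMost_eq)
  note S2 = indep_vars_expectation_sum_square[OF U_indep U_sq U_mean U_var, folded S_def]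
  define V where "V = sample_variance Z"
  have [measurable]: "V n \<in> borel_measurable M" for n
    unfolding V_def by (rule borel_measurable_sample_variance) (rule Zrv)
  have [measurable]: "cal_statistic c Z n \<in> borel_measurable M" for n
    by (rule borel_measurable_cal_statistic) (rule Zrv)
  define Q where "Q n \<omega> = (\<Sum>i<n. (U i \<omega>)\<^sup>2) / real n" for n \<omega>
  have Q_int: "integrable M (Q n)" for n unfolding Q_def using U_sq by auto
  define L where "L n = expectation (\<lambda>\<omega>. \<bar>Q n \<omega> - v\<bar>)" for n
  \<comment> \<open>The law of large numbers is applied to the squares, whose common mean is
    \<open>v\<close>.\<close>
  have L_lim: "L \<longlonglongrightarrow> 0"
  proof -
    have ind: "indep_vars (\<lambda>_. borel) (\<lambda>i \<omega>. (U i \<omega>)\<^sup>2) UNIV"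
      by (rule indep_vars_compose2[OF U_indep]) measurable
    have "distr M borel (\<lambda>\<omega>. (U i \<omega>)\<^sup>2) = distr \<nu> borel (\<lambda>x. x\<^sup>2)" for i
      by (subst U_distr[of i, symmetric]) (simp add: distr_distr comp_def)
    from weak_law_of_large_numbers_L1[OF ind this] sq\<nu> show ?thesis
      by (simp add: L_def[abs_def] Q_def v_def integrable_distr_eq integral_distr)
  qed
  \<comment> \<open>Up to the factor \<open>n / (n - 1) \<le> 2\<close> the error is that of the
    uncentred second moment \<open>Q n\<close>. The remaining terms carry the factor
    \<open>1 / (n - 1) \<le> 2 / n\<close>; both estimates need \<open>n \<ge> 2\<close>.\<close>
  have V_bound: "\<bar>V n \<omega> - v\<bar> \<le> 2 * \<bar>Q n \<omega> - v\<bar> + (2 * v + 2 * ((S n \<omega>)\<^sup>2 / real n)) / real n"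
    if n: "n \<ge> 2" for n \<omega>
  proof -
    let ?r = "real n / (real n - 1)"
    have r: "0 < ?r" "?r \<le> 2" "1 / (real n - 1) \<le> 2 / real n" "0 < 1 / (real n - 1)"
      using n by (auto simp: field_simps)
    \<comment> \<open>The triangle inequality in abstract letters, so that the products below can be
      treated as atoms.\<close>
    have tri: "\<bar>p + q - s\<bar> \<le> p' + (q' + s')"
      if "\<bar>p\<bar> \<le> p'" "0 \<le> q" "q \<le> q'" "0 \<le> s" "s \<le> s'" for p q s p' q' s' :: real
      using that by linarith
    have "V n \<omega> - v = ?r * (Q n \<omega> - v) + 1 / (real n - 1) * v
        - 1 / (real n - 1) * ((S n \<omega>)\<^sup>2 / real n)"
    proof -
      have "?r * (Q n \<omega> - v) = (real n * Q n \<omega> - real n * v) / (real n - 1)"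
        by (simp add: right_diff_distrib diff_divide_distrib)
      moreover have "v = (real n * v - v) / (real n - 1)" using n by (simp add: field_simps)
      moreover have "V n \<omega> = (real n * Q n \<omega> - (S n \<omega>)\<^sup>2 / real n) / (real n - 1)"
        using n sum_shift[of "\<lambda>x. x" \<omega> n] sum_shift[of "\<lambda>x. x\<^sup>2" \<omega> n]
        by (simp add: V_def Q_def S_def sample_variance_eq)
      ultimately show ?thesis
        unfolding diff_divide_distrib times_divide_eq_left mult_1_left by linarith
    qed
    moreover have "\<bar>?r * (Q n \<omega> - v)\<bar> \<le> 2 * \<bar>Q n \<omega> - v\<bar>"
      unfolding abs_mult using r by (intro mult_right_mono) auto
    moreover have "0 \<le> 1 / (real n - 1) * v" "1 / (real n - 1) * v \<le> 2 / real n * v"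
      using mult_right_mono[OF r(3), of v] r v by simp_all
    moreover have "0 \<le> 1 / (real n - 1) * ((S n \<omega>)\<^sup>2 / real n)"
      "1 / (real n - 1) * ((S n \<omega>)\<^sup>2 / real n) \<le> 2 / real n * ((S n \<omega>)\<^sup>2 / real n)"
      using mult_right_mono[OF r(3), of "(S n \<omega>)\<^sup>2 / real n"] r by simp_all
    ultimately have "\<bar>V n \<omega> - v\<bar>
        \<le> 2 * \<bar>Q n \<omega> - v\<bar> + (2 / real n * v + 2 / real n * ((S n \<omega>)\<^sup>2 / real n))"
      by (simp only: tri)
    then show ?thesis by (simp add: add_divide_distrib)
  qed
  have bound_int: "integrable M
      (\<lambda>\<omega>. 2 * \<bar>Q n \<omega> - v\<bar> + (2 * v + 2 * ((S n \<omega>)\<^sup>2 / real n)) / real n)" for n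
    using Q_int S2(1) by auto
  have V_int: "integrable M (\<lambda>\<omega>. \<bar>V n \<omega> - v\<bar>)" if n: "n \<ge> 2" for n
    by (rule Bochner_Integration.integrable_bound[OF bound_int[of n]])
      (use V_bound[OF n] in \<open>auto intro!: AE_I2 order_trans[OF _ abs_ge_self]\<close>)
  define D where "D n = expectation (\<lambda>\<omega>. \<bar>V n \<omega> - v\<bar>)" for n
  have D_lim: "D \<longlonglongrightarrow> 0"
  proof (rule tendsto_sandwich[where f="\<lambda>_. 0" and h="\<lambda>n. 2 * L n + 4 * v / real n"])
    show "\<forall>\<^sub>F n in sequentially. D n \<le> 2 * L n + 4 * v / real n"
    proof (rule eventually_sequentiallyI)
      fix n :: nat assume n: "n \<ge> 2"
      have "D n \<le> expectation
          (\<lambda>\<omega>. 2 * \<bar>Q n \<omega> - v\<bar> + (2 * v + 2 * ((S n \<omega>)\<^sup>2 / real n)) / real n)"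
        unfolding D_def by (rule integral_mono[OF V_int[OF n] bound_int V_bound[OF n]])
      \<comment> \<open>The second moment of \<open>S n\<close> is \<open>n * v\<close>, so the
        expectation of \<open>(S n \<omega>)\<^sup>2 / n\<close> is \<open>v\<close> and the
        remainder contributes \<open>(2 * v + 2 * v) / n\<close>.\<close>
      also have "\<dots> = 2 * L n + 4 * v / real n"
        using Q_int S2[of n] n by (simp add: L_def prob_space)
      finally show "D n \<le> 2 * L n + 4 * v / real n" .
    qed
    have "(\<lambda>n. 2 * L n + 4 * v / real n) \<longlonglongrightarrow> 2 * 0 + 0"
      by (intro tendsto_add tendsto_mult tendsto_const L_lim lim_const_over_n)
    then show "(\<lambda>n. 2 * L n + 4 * v / real n) \<longlonglongrightarrow> 0" by simp
  qed (auto simp: D_def)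
  define b where "b n \<omega> = S n \<omega> / sqrt (real n * v)" for n \<omega>
  have [measurable]: "b n \<in> borel_measurable M" for n unfolding b_def by measurable
  have b_sq: "integrable M (\<lambda>\<omega>. (b n \<omega>)\<^sup>2)" for n
    unfolding b_def power_divide using S2(1) by simp
  \<comment> \<open>The second moment of \<open>b n\<close> is 1; the bound 2 is
    \<open>e + 1 / e\<close> at \<open>e = 1\<close>.\<close>
  have b_abs: "expectation (\<lambda>\<omega>. \<bar>b n \<omega>\<bar>) \<le> 2" if "n > 0" for n
  proof -
    have "expectation (\<lambda>\<omega>. (b n \<omega>)\<^sup>2) = 1"
      unfolding b_def power_divide using S2[of n] that v by simp
    then show ?thesis using expectation_abs_le_square[of 1 "b n"] b_sq by simp
  qed
  have b_int: "integrable M (b n)" for n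
    by (rule square_integrable_imp_integrable[OF _ b_sq]) simp
  have "weak_conv_m (\<lambda>n. distr M borel (b n)) std_normal_distribution"
  proof -
    have "variance (U i) = (sqrt v)\<^sup>2" for i using v U_mean U_var by simp
    from central_limit_theorem_zero_mean[OF U_indep U_mean _ U_sq this U_distr]
    show ?thesis using v unfolding b_def[abs_def] S_def by simp
  qed
  \<comment> \<open>Passing to characteristic functions allows the error of replacing
    \<open>v\<close> by the sample variance to be estimated under the expectation.\<close>
  then have b_char: "(\<lambda>n. char (distr M borel (b n)) t) \<longlonglongrightarrow> char std_normal_distribution t" for t
    by (intro levy_continuity1 real_dist_normal_dist real_distribution_distr) auto
  show ?thesis
  proof (rule levy_continuity)
    fix t :: real
    let ?d = "\<lambda>n. char (distr M borel (cal_statistic c Z n)) t - char (distr M borel (b n)) t"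
    have main: "cmod (?d n) \<le> 4 * \<delta> * \<bar>t\<bar> + 2 * D n / (\<delta> * v)"
      if \<delta>: "0 < \<delta>" "\<delta> \<le> 1 / 2" and n: "n \<ge> 2" for \<delta> n
    proof -
      have int: "integrable M (\<lambda>\<omega>. iexp (t * f \<omega>))" if "f \<in> borel_measurable M" for f
        using that by (intro integrable_const_bound[where B=1]) auto
      have "?d n = expectation (\<lambda>\<omega>. iexp (t * cal_statistic c Z n \<omega>) - iexp (t * b n \<omega>))"
        unfolding char_def using int by (simp add: integral_distr)
      also have "cmod \<dots> \<le> expectation
          (\<lambda>\<omega>. cmod (iexp (t * cal_statistic c Z n \<omega>) - iexp (t * b n \<omega>)))"
        by (rule integral_norm_bound)
      also have "\<dots> \<le> expectation (\<lambda>\<omega>. 2 * \<delta> * \<bar>t\<bar> * \<bar>b n \<omega>\<bar> + 2 * \<bar>V n \<omega> - v\<bar> / (\<delta> * v))"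
      proof (rule integral_mono)
        show "cmod (iexp (t * cal_statistic c Z n \<omega>) - iexp (t * b n \<omega>))
            \<le> 2 * \<delta> * \<bar>t\<bar> * \<bar>b n \<omega>\<bar> + 2 * \<bar>V n \<omega> - v\<bar> / (\<delta> * v)" for \<omega>
          using cal_statistic_iexp_bound[OF _ v \<delta>, of n t c Z \<omega>] n
          unfolding V_def b_def S_def sum_shift[of "\<lambda>x. x" \<omega> n] by simp
        show "integrable M (\<lambda>\<omega>. cmod (iexp (t * cal_statistic c Z n \<omega>) - iexp (t * b n \<omega>)))"
          using int by (intro integrable_norm Bochner_Integration.integrable_diff) auto
      qed (use b_int V_int[OF n] in auto)
      also have "\<dots> = 2 * \<delta> * \<bar>t\<bar> * expectation (\<lambda>\<omega>. \<bar>b n \<omega>\<bar>) + 2 * D n / (\<delta> * v)"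
        using b_int[of n] V_int[OF n] by (simp add: D_def)
      also have "\<dots> \<le> 2 * \<delta> * \<bar>t\<bar> * 2 + 2 * D n / (\<delta> * v)"
        using b_abs[of n] n \<delta> by (intro add_mono mult_left_mono) auto
      finally show ?thesis by simp
    qed
    have "?d \<longlonglongrightarrow> 0"
    proof (rule LIMSEQ_I)
      fix r :: real assume "r > 0"
      \<comment> \<open>\<open>\<delta>\<close> is chosen first, making the first term of
        \<open>main\<close> less than \<open>r / 2\<close> for every n; then n is taken large for
        fixed \<open>\<delta>\<close>. Adding 1 to \<open>\<bar>t\<bar>\<close> covers
        \<open>t = 0\<close>.\<close>
      define \<delta> where "\<delta> = min (1 / 2) (r / (8 * (\<bar>t\<bar> + 1)))"
      have pos: "0 < 8 * (\<bar>t\<bar> + 1)" by simp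
      then have "0 < r / (8 * (\<bar>t\<bar> + 1))" using \<open>r > 0\<close> by (rule divide_pos_pos[rotated])
      then have \<delta>: "0 < \<delta>" "\<delta> \<le> 1 / 2"
        unfolding \<delta>_def by (auto simp only: min_less_iff_conj min.cobounded1)
      have "\<delta> \<le> r / (8 * (\<bar>t\<bar> + 1))" unfolding \<delta>_def by (rule min.cobounded2)
      then have "\<delta> * (8 * (\<bar>t\<bar> + 1)) \<le> r" unfolding pos_le_divide_eq[OF pos] .
      then have t: "4 * \<delta> * \<bar>t\<bar> < r / 2" using \<delta> by (simp add: algebra_simps)
      have "(\<lambda>n. 2 / (\<delta> * v) * D n) \<longlonglongrightarrow> 2 / (\<delta> * v) * 0"
        by (intro tendsto_mult tendsto_const D_lim)
      then have "\<forall>\<^sub>F n in sequentially. 2 / (\<delta> * v) * D n < r / 2"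
        by (rule order_tendstoD) (use \<open>r > 0\<close> in simp)
      then obtain n0 where "\<And>n. n \<ge> n0 \<Longrightarrow> 2 / (\<delta> * v) * D n < r / 2"
        by (auto simp: eventually_sequentially)
      then have "norm (?d n - 0) < r" if "n \<ge> max 2 n0" for n
        using main[OF \<delta>, of n] t that by force
      then show "\<exists>no. \<forall>n\<ge>no. norm (?d n - 0) < r" by blast
    qed
    from tendsto_add[OF this b_char[of t]]
    show "(\<lambda>n. char (distr M borel (cal_statistic c Z n)) t) \<longlonglongrightarrow> char std_normal_distribution t"
      by simp
  qed (auto intro!: real_distribution_distr real_dist_normal_dist)
qed

subsection \<open>Conditional distributions\<close>

lemma subalgebra_generated_algebra:
  assumes "U \<in> measurable M S"
  shows "subalgebra M (generated_algebra M S U)"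
proof -
  have "U \<in> space M \<rightarrow> space S" using assms by (auto dest: measurable_space)
  then show ?thesis
    using assms by (auto simp: subalgebra_def sets_vimage_algebra2 intro: measurable_sets)
qed

lemma measurable_generated_algebra:
  assumes "U \<in> measurable M S"
  shows "U \<in> measurable (generated_algebra M S U) S"
  using assms by (intro measurable_vimage_algebra1) (auto dest: measurable_space)

lemma (in prob_space) finite_measure_subalgebra_generated_algebra:
  assumes "U \<in> measurable M S"
  shows "finite_measure_subalgebra M (generated_algebra M S U)"
  using subalgebra_generated_algebra[OF assms] finite_measure_axioms
  by (simp add: finite_measure_subalgebra_def finite_measure_subalgebra_axioms_def)

text \<open>Independence makes both sides agree on rectangles, and these determine a product of
  sigma-finite measures.\<close>

lemma (in prob_space) distr_pair_indep_rvs: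
  assumes "indep_rvs M S U T V"
  shows "distr M (S \<Otimes>\<^sub>M T) (\<lambda>\<omega>. (U \<omega>, V \<omega>)) = distr M S U \<Otimes>\<^sub>M distr M T V"
proof (rule pair_measure_eqI[symmetric])
  have [measurable]: "U \<in> measurable M S" "V \<in> measurable M T"
    and ind: "indep_set (sets (generated_algebra M S U)) (sets (generated_algebra M T V))"
    using assms by (auto simp: indep_rvs_def)
  show "sigma_finite_measure (distr M S U)" "sigma_finite_measure (distr M T V)"
    by (auto intro!: prob_space_imp_sigma_finite prob_space_distr)
  fix A B assume AB: "A \<in> sets (distr M S U)" "B \<in> sets (distr M T V)"
  then have [measurable]: "A \<in> sets S" "B \<in> sets T" by auto
  have "prob ((U -` A \<inter> space M) \<inter> (V -` B \<inter> space M)) = prob (U -` A \<inter> space M) * prob (V -` B \<inter> space M)"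
    by (rule indep_setD[OF ind]) (auto intro: in_vimage_algebra)
  moreover have "(\<lambda>\<omega>. (U \<omega>, V \<omega>)) -` (A \<times> B) \<inter> space M = (U -` A \<inter> space M) \<inter> (V -` B \<inter> space M)"
    by auto
  ultimately show "emeasure (distr M S U) A * emeasure (distr M T V) B
      = emeasure (distr M (S \<Otimes>\<^sub>M T) (\<lambda>\<omega>. (U \<omega>, V \<omega>))) (A \<times> B)"
    by (simp add: emeasure_distr emeasure_eq_measure ennreal_mult)
qed (simp cong: sets_pair_measure_cong)

text \<open>Fubini for the joint law, which is a product: the probability of \<open>A\<close> is the
  integral of the probabilities of its sections, and \<open>k u\<close> is the section probability
  with \<open>U\<close> frozen at \<open>u\<close>.\<close>

lemma (in prob_space) prob_section_indep_rvs:
  assumes indep: "indep_rvs M S U T V" and A[measurable]: "A \<in> sets (S \<Otimes>\<^sub>M T)"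
  defines "k \<equiv> \<lambda>u. prob {\<omega>' \<in> space M. (u, V \<omega>') \<in> A}"
  shows "k \<in> borel_measurable S"
    and "prob {\<omega> \<in> space M. (U \<omega>, V \<omega>) \<in> A} = expectation (\<lambda>\<omega>. k (U \<omega>))"
proof -
  have [measurable]: "U \<in> measurable M S" "V \<in> measurable M T"
    using indep by (auto simp: indep_rvs_def)
  interpret PV: prob_space "distr M T V" by (rule prob_space_distr) simp
  interpret PU: prob_space "distr M S U" by (rule prob_space_distr) simp
  have A': "A \<in> sets (distr M S U \<Otimes>\<^sub>M distr M T V)"
    using A by (simp cong: sets_pair_measure_cong)
  have k: "emeasure (distr M T V) (Pair u -` A) = ennreal (k u)" for u
  proof -
    have "Pair u -` A \<in> sets T" using A by (rule sets_Pair1)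
    moreover have "V -` (Pair u -` A) \<inter> space M = {\<omega>' \<in> space M. (u, V \<omega>') \<in> A}" by auto
    ultimately show ?thesis by (simp add: emeasure_distr k_def emeasure_eq_measure)
  qed
  have "(\<lambda>u. enn2real (emeasure (distr M T V) (Pair u -` A))) \<in> borel_measurable (distr M S U)"
    using PV.measurable_emeasure_Pair[OF A'] by measurable
  then show k_meas[measurable]: "k \<in> borel_measurable S"
    unfolding k by (simp add: k_def)
  have "emeasure (distr M (S \<Otimes>\<^sub>M T) (\<lambda>\<omega>. (U \<omega>, V \<omega>))) A = (\<integral>\<^sup>+u. k u \<partial>distr M S U)"
    unfolding distr_pair_indep_rvs[OF indep] PV.emeasure_pair_measure_alt[OF A'] k ..
  also have "\<dots> = (\<integral>\<^sup>+\<omega>. k (U \<omega>) \<partial>M)" by (simp add: nn_integral_distr)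
  also have "\<dots> = ennreal (expectation (\<lambda>\<omega>. k (U \<omega>)))"
    by (intro nn_integral_eq_integral integrable_const_bound[where B=1]) (auto simp: k_def)
  also have "emeasure (distr M (S \<Otimes>\<^sub>M T) (\<lambda>\<omega>. (U \<omega>, V \<omega>))) A
      = ennreal (prob {\<omega> \<in> space M. (U \<omega>, V \<omega>) \<in> A})"
    by (simp add: emeasure_distr emeasure_eq_measure vimage_def Int_def conj_commute)
  finally show "prob {\<omega> \<in> space M. (U \<omega>, V \<omega>) \<in> A} = expectation (\<lambda>\<omega>. k (U \<omega>))"
    by (subst (asm) ennreal_inj) (auto simp: k_def)
qed

text \<open>The freezing principle. The right-hand side is a measurable function of
  \<open>U\<close>, so only its integrals over events of the generated algebra need checking, and
  the section formula supplies them.\<close>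

lemma (in prob_space) alg_cond_prob_indep_rvs:
  assumes indep: "indep_rvs M S U T V" and A[measurable]: "A \<in> sets (S \<Otimes>\<^sub>M T)"
  shows "AE \<omega> in M. alg_cond_prob M (generated_algebra M S U) (\<lambda>\<omega>. (U \<omega>, V \<omega>) \<in> A) \<omega>
    = prob {\<omega>' \<in> space M. (U \<omega>, V \<omega>') \<in> A}"
proof -
  have [measurable]: "U \<in> measurable M S" "V \<in> measurable M T"
    using indep by (auto simp: indep_rvs_def)
  have V_space: "V \<omega> \<in> space T" if "\<omega> \<in> space M" for \<omega> using that by (rule measurable_space[rotated]) simp
  let ?F = "generated_algebra M S U"
  interpret F: finite_measure_subalgebra M ?F
    by (rule finite_measure_subalgebra_generated_algebra) simp
  define k where "k u = prob {\<omega>' \<in> space M. (u, V \<omega>') \<in> A}" for u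
  note k = prob_section_indep_rvs[OF indep A, folded k_def]
  have [measurable]: "k \<in> borel_measurable S" by (rule k)
  let ?E = "{\<omega> \<in> space M. (U \<omega>, V \<omega>) \<in> A}"
  have "AE \<omega> in M. real_cond_exp M ?F (indicator ?E) \<omega> = k (U \<omega>)"
  proof (rule F.real_cond_exp_charact)
    show "integrable M (indicat_real ?E)"
      by (intro integrable_real_indicator) (measurable, simp add: less_top[symmetric])
    show "integrable M (\<lambda>\<omega>. k (U \<omega>))"
      by (rule integrable_const_bound[where B=1]) (auto simp: k_def)
    show "(\<lambda>\<omega>. k (U \<omega>)) \<in> borel_measurable ?F"
      by (rule measurable_compose[OF measurable_generated_algebra]) auto
    fix C assume "C \<in> sets ?F"
    moreover have "U \<in> space M \<rightarrow> space S" by (auto intro: measurable_space)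
    ultimately obtain C' where C': "C = U -` C' \<inter> space M" and [measurable]: "C' \<in> sets S"
      by (auto simp: sets_vimage_algebra2)
    \<comment> \<open>Restricting to \<open>C\<close> is absorbed into the product set, so the
      section formula applies to \<open>?A\<close> unchanged.\<close>
    let ?A = "A \<inter> (C' \<times> space T)"
    have "(\<integral>\<omega>\<in>C. indicat_real ?E \<omega> \<partial>M) = expectation (indicat_real {\<omega> \<in> space M. (U \<omega>, V \<omega>) \<in> ?A})"
      unfolding set_lebesgue_integral_def C'
      by (rule Bochner_Integration.integral_cong)
        (auto simp: indicator_def V_space)
    also have "\<dots> = prob {\<omega> \<in> space M. (U \<omega>, V \<omega>) \<in> ?A}" by simp
    also have "\<dots> = expectation (\<lambda>\<omega>. prob {\<omega>' \<in> space M. (U \<omega>, V \<omega>') \<in> ?A})"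
      by (rule prob_section_indep_rvs[OF indep]) measurable
    also have "\<dots> = (\<integral>\<omega>\<in>C. k (U \<omega>) \<partial>M)"
      unfolding set_lebesgue_integral_def
    proof (rule Bochner_Integration.integral_cong)
      fix \<omega> assume \<omega>: "\<omega> \<in> space M"
      have "{\<omega>' \<in> space M. (U \<omega>, V \<omega>') \<in> ?A} = (if \<omega> \<in> C then {\<omega>' \<in> space M. (U \<omega>, V \<omega>') \<in> A} else {})"
        using \<omega> by (auto simp: C' V_space)
      then show "prob {\<omega>' \<in> space M. (U \<omega>, V \<omega>') \<in> ?A} = indicator C \<omega> *\<^sub>R k (U \<omega>)"
        by (simp add: k_def)
    qed simp
    finally show "(\<integral>\<omega>\<in>C. indicat_real ?E \<omega> \<partial>M) = (\<integral>\<omega>\<in>C. k (U \<omega>) \<partial>M)" .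
  qed
  then show ?thesis by (simp add: alg_cond_prob_def k_def)
qed

section \<open>Uniqueness of real conditional distributions, and their variance\<close>

text \<open>Were the distribution functions different at some \<open>x\<close>, right continuity
  would keep them different on an interval to the right of \<open>x\<close>, which contains a
  rational. Countably many test sets are what an almost-sure argument requires.\<close>

lemma real_distribution_eqI_rat:
  assumes "real_distribution \<nu>" "real_distribution \<nu>'"
    and eq: "\<And>q :: rat. measure \<nu> {..real_of_rat q} = measure \<nu>' {..real_of_rat q}"
  shows "\<nu> = \<nu>'"
proof (rule cdf_unique)
  interpret \<nu>: real_distribution \<nu> by fact
  interpret \<nu>': real_distribution \<nu>' by fact
  show "cdf \<nu> = cdf \<nu>'"
  proof (rule ext, rule ccontr)
    fix x assume neq: "cdf \<nu> x \<noteq> cdf \<nu>' x"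
    let ?d = "\<lambda>y. cdf \<nu> y - cdf \<nu>' y"
    have "(?d \<longlongrightarrow> ?d x) (at_right x)"
      using \<nu>.cdf_is_right_cont[of x] \<nu>'.cdf_is_right_cont[of x]
      by (intro tendsto_diff) (auto simp: continuous_within)
    then have "\<forall>\<^sub>F y in at_right x. ?d y \<noteq> 0" by (rule tendsto_imp_eventually_ne) (use neq in simp)
    then obtain b where "b > x" and b: "\<And>y. x < y \<Longrightarrow> y < b \<Longrightarrow> ?d y \<noteq> 0"
      by (auto simp: eventually_at_right_field)
    obtain q where "x < real_of_rat q" "real_of_rat q < b" using of_rat_dense[OF \<open>b > x\<close>] by auto
    then show False using b eq by (auto simp: cdf_def)
  qed
qed fact+

text \<open>Two versions agree on each Borel set outside a null set depending on that set. Using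
  only half-lines with rational endpoints leaves a single null set.\<close>

lemma is_cond_distr_unique:
  fixes Z :: "'a \<Rightarrow> real"
  assumes "space F = space M" "is_cond_distr M F borel Z \<kappa>" "is_cond_distr M F borel Z \<kappa>'"
  shows "AE \<omega> in M. \<kappa> \<omega> = \<kappa>' \<omega>"
proof -
  have ae: "AE \<omega> in M. \<forall>q::rat. measure (\<kappa> \<omega>) {..real_of_rat q} = measure (\<kappa>' \<omega>) {..real_of_rat q}"
    unfolding AE_all_countable
  proof
    fix q :: rat
    have "AE \<omega> in M. measure (k \<omega>) {..real_of_rat q} = alg_cond_prob M F (\<lambda>\<omega>'. Z \<omega>' \<in> {..real_of_rat q}) \<omega>"
      if "is_cond_distr M F borel Z k" for k
      using that unfolding is_cond_distr_def by (auto simp del: atMost_iff)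
    from this[OF assms(2)] this[OF assms(3)]
    show "AE \<omega> in M. measure (\<kappa> \<omega>) {..real_of_rat q} = measure (\<kappa>' \<omega>) {..real_of_rat q}"
      by eventually_elim simp
  qed
  have real: "real_distribution (k \<omega>)" if "is_cond_distr M F borel Z k" "\<omega> \<in> space M" for k \<omega>
  proof -
    have "k \<omega> \<in> space (prob_algebra borel)"
      using that assms(1) measurable_space[of k F "prob_algebra borel" \<omega>]
      by (auto simp: is_cond_distr_def)
    then show ?thesis
      by (auto simp: space_prob_algebra real_distribution_def real_distribution_axioms_def
          dest: sets_eq_imp_space_eq)
  qed
  from ae AE_space show ?thesis
    by eventually_elim (rule real_distribution_eqI_rat[OF real[OF assms(2)] real[OF assms(3)]], simp_all)
qed

text \<open>\<open>cond_distr\<close> is a version picked by choice; the given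
  \<open>\<kappa>\<close> shows that the choice succeeds, and uniqueness identifies the result with
  \<open>\<kappa>\<close>.\<close>

lemma cond_variance_eq:
  assumes "space F = space M" "is_cond_distr M F borel Z \<kappa>"
  shows "AE \<omega> in M. cond_variance M F Z \<omega> = distr_variance (\<kappa> \<omega>)"
proof -
  have "is_cond_distr M F borel Z (cond_distr M F borel Z)"
    unfolding cond_distr_def by (rule someI[where P="is_cond_distr M F borel Z"]) (rule assms)
  from is_cond_distr_unique[OF assms(1) this assms(2)] show ?thesis
    by eventually_elim (simp add: cond_variance_def)
qed

text \<open>The argument works for any real centre \<open>m\<close>, so it is not circular: the mean
  may be read before it is known to exist.\<close>

lemma (in real_distribution) distr_variance_finite:
  assumes "distr_variance M < \<infinity>"
  shows "integrable M (\<lambda>x. x\<^sup>2)" and "integrable M (\<lambda>x. x)"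
proof -
  define m where "m = (\<integral>t. t \<partial>M)"
  have "integrable M (\<lambda>x. (x - m)\<^sup>2)"
    using assms by (intro integrableI_nonneg) (auto simp: distr_variance_def m_def)
  then have bound: "integrable M (\<lambda>x. 2 * (x - m)\<^sup>2 + 2 * m\<^sup>2)" by simp
  show sq: "integrable M (\<lambda>x. x\<^sup>2)"
  proof (rule Bochner_Integration.integrable_bound[OF bound])
    have "x\<^sup>2 \<le> 2 * (x - m)\<^sup>2 + 2 * m\<^sup>2" for x
      \<comment> \<open>The difference of the two sides is exactly
        \<open>(x - 2 * m)\<^sup>2\<close>.\<close>
      using zero_le_power2[of "x - 2 * m"] by (simp add: power2_eq_square algebra_simps)
    then show "AE x in M. norm (x\<^sup>2) \<le> norm (2 * (x - m)\<^sup>2 + 2 * m\<^sup>2)" by simp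
  qed simp
  show "integrable M (\<lambda>x. x)" by (rule square_integrable_imp_integrable[OF _ sq]) simp
qed

text \<open>Calibration says that the residual has conditional expectation 0 given \<open>X\<close>;
  a factor that depends on \<open>X\<close> alone can be pulled out as soon as the product is
  integrable.\<close>

lemma (in prob_space) calibrated_orthogonal:
  assumes Y: "integrable M Y" and [measurable]: "X \<in> measurable M N" "\<mu> \<in> borel_measurable N"
      "f \<in> borel_measurable N"
    and cal: "calibrated M N Y X \<mu>"
    and int: "integrable M (\<lambda>\<omega>. (Y \<omega> - \<mu> (X \<omega>)) * f (X \<omega>))"
  shows "expectation (\<lambda>\<omega>. (Y \<omega> - \<mu> (X \<omega>)) * f (X \<omega>)) = 0"
proof -
  let ?F = "generated_algebra M N X"
  interpret F: finite_measure_subalgebra M ?F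
    by (rule finite_measure_subalgebra_generated_algebra) simp
  have XF[measurable]: "X \<in> measurable ?F N" by (rule measurable_generated_algebra) simp
  have [measurable]: "Y \<in> borel_measurable M" using Y by simp
  have cal: "AE \<omega> in M. \<mu> (X \<omega>) = real_cond_exp M ?F Y \<omega>"
    using cal by (simp add: calibrated_def)
  \<comment> \<open>Integrability of the prediction is inherited from \<open>Y\<close>, since
    calibration makes it a conditional expectation of \<open>Y\<close>.\<close>
  have \<mu>X: "integrable M (\<lambda>\<omega>. \<mu> (X \<omega>))"
    by (subst integrable_cong_AE[OF _ _ cal]) (auto intro: F.real_cond_exp_int Y)
  have "AE \<omega> in M. real_cond_exp M ?F (\<lambda>\<omega>. \<mu> (X \<omega>)) \<omega> = \<mu> (X \<omega>)"
    by (rule F.real_cond_exp_F_meas[OF \<mu>X]) measurable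
  with F.real_cond_exp_diff[OF Y \<mu>X] cal
  have zero: "AE \<omega> in M. real_cond_exp M ?F (\<lambda>\<omega>. Y \<omega> - \<mu> (X \<omega>)) \<omega> = 0"
    by eventually_elim simp
  have "expectation (\<lambda>\<omega>. f (X \<omega>) * (Y \<omega> - \<mu> (X \<omega>)))
      = expectation (\<lambda>\<omega>. f (X \<omega>) * real_cond_exp M ?F (\<lambda>\<omega>. Y \<omega> - \<mu> (X \<omega>)) \<omega>)"
    using int by (intro F.real_cond_exp_intg(2)[symmetric]) (auto simp: mult.commute)
  also have "\<dots> = expectation (\<lambda>\<omega>. 0)"
    by (rule integral_cong_AE) (use zero in auto)
  finally show ?thesis by (simp add: mult.commute)
qed

subsection \<open>I.i.d. variables with an independent random parameter\<close>

text \<open>The two sample points may lie in different spaces, so the statistic can be transported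
  to the space of parameter and data.\<close>

lemma cal_statistic_cong:
  assumes "\<And>i. i \<ge> 1 \<Longrightarrow> Z i \<omega> = Z' i \<omega>'"
  shows "cal_statistic c Z n \<omega> = cal_statistic c Z' n \<omega>'"
  using assms by (simp add: cal_statistic_def sample_variance_def sample_mean_def)

text \<open>Since \<open>\<nu>\<close> is the same for all \<omega>, so are its continuity points.
  At each of them the distribution functions are bounded by 1 and dominated convergence
  applies.\<close>

lemma (in prob_space) weak_conv_m_mixture:
  assumes [measurable]: "\<And>n. T n \<in> borel_measurable M"
    and real: "\<And>n \<omega>. \<omega> \<in> space M \<Longrightarrow> real_distribution (\<kappa> n \<omega>)"
    and [measurable]: "\<And>n x. (\<lambda>\<omega>. cdf (\<kappa> n \<omega>) x) \<in> borel_measurable M"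
    and mix: "\<And>n x. cdf (distr M borel (T n)) x = expectation (\<lambda>\<omega>. cdf (\<kappa> n \<omega>) x)"
    and conv: "AE \<omega> in M. weak_conv_m (\<lambda>n. \<kappa> n \<omega>) \<nu>"
  shows "weak_conv_m (\<lambda>n. distr M borel (T n)) \<nu>"
  unfolding weak_conv_m_def weak_conv_def mix
proof (intro allI impI)
  fix x assume cont: "isCont (cdf \<nu>) x"
  have "(\<lambda>n. expectation (\<lambda>\<omega>. cdf (\<kappa> n \<omega>) x)) \<longlonglongrightarrow> expectation (\<lambda>\<omega>. cdf \<nu> x)"
  proof (rule integral_dominated_convergence[where w="\<lambda>_. 1"])
    show "AE \<omega> in M. (\<lambda>n. cdf (\<kappa> n \<omega>) x) \<longlonglongrightarrow> cdf \<nu> x"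
      using conv by eventually_elim (use cont in \<open>auto simp: weak_conv_m_def weak_conv_def\<close>)
    show "AE \<omega> in M. norm (cdf (\<kappa> n \<omega>) x) \<le> 1" for n
    proof (rule AE_I2)
      fix \<omega> assume "\<omega> \<in> space M"
      then have "real_distribution (\<kappa> n \<omega>)" by (rule real)
      then have "prob_space (\<kappa> n \<omega>)" by (simp add: real_distribution_def)
      then show "norm (cdf (\<kappa> n \<omega>) x) \<le> 1" by (simp add: cdf_def prob_space.prob_le_1)
    qed
  qed simp_all
  then show "(\<lambda>n. expectation (\<lambda>\<omega>. cdf (\<kappa> n \<omega>) x)) \<longlonglongrightarrow> cdf \<nu> x" by (simp add: prob_space)
qed

text \<open>Abstract form of the test: \<open>W\<close> are the observations with common law
  \<open>D\<close>, \<open>B\<close> is the batch, and \<open>h b w\<close> is the weighted residual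
  of observation \<open>w\<close> when the batch has value \<open>b\<close>.\<close>

locale iid_with_independent_parameter = prob_space M
  for M :: "'a measure" +
  fixes I :: "'i set" and L :: "'w measure" and W :: "'i \<Rightarrow> 'a \<Rightarrow> 'w" and D :: "'w measure"
    and S :: "'s measure" and B :: "'a \<Rightarrow> 's" and h :: "'s \<Rightarrow> 'w \<Rightarrow> real"
  assumes W_indep: "indep_vars (\<lambda>_. L) W I"
    and W_distr: "\<And>i. i \<in> I \<Longrightarrow> distr M L (W i) = D"
    and B_W: "indep_rvs M S B (PiM I (\<lambda>_. L)) (\<lambda>\<omega>. \<lambda>i\<in>I. W i \<omega>)"
    and h[measurable]: "(\<lambda>(b, w). h b w) \<in> borel_measurable (S \<Otimes>\<^sub>M L)"
begin

abbreviation "F \<equiv> generated_algebra M S B"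

abbreviation "Z \<equiv> \<lambda>i \<omega>. h (B \<omega>) (W i \<omega>)"

abbreviation "frozen b \<equiv> \<lambda>i \<omega>. h b (W i \<omega>)"

abbreviation "law b \<equiv> distr D borel (h b)"

lemma B_measurable[measurable]: "B \<in> measurable M S"
  using B_W by (simp add: indep_rvs_def)

lemma W_measurable[measurable (raw)]: "i \<in> I \<Longrightarrow> W i \<in> measurable M L"
  using W_indep by (simp add: indep_vars_def)

lemma h_section[measurable]: "b \<in> space S \<Longrightarrow> h b \<in> borel_measurable L"
  using measurable_Pair2[OF h] by simp

lemma Z_measurable: "i \<in> I \<Longrightarrow> Z i \<in> borel_measurable M"
  by measurable

lemma frozen_measurable: "b \<in> space S \<Longrightarrow> i \<in> I \<Longrightarrow> frozen b i \<in> borel_measurable M"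
  by measurable

lemma frozen_distr:
  assumes "b \<in> space S" "i \<in> I"
  shows "distr M borel (frozen b i) = law b"
  unfolding W_distr[OF assms(2), symmetric] using assms
  by (subst distr_distr) (auto simp: comp_def)

lemma frozen_indep:
  assumes "b \<in> space S"
  shows "indep_vars (\<lambda>_. borel) (frozen b) I"
  using indep_vars_compose2[OF W_indep, of "\<lambda>_. h b" "\<lambda>_. borel"] assms
  by simp

lemma alg_cond_prob_Z:
  assumes J: "finite J" "J \<subseteq> I" and A: "\<And>j. j \<in> J \<Longrightarrow> A j \<in> sets borel"
  shows "AE \<omega> in M. alg_cond_prob M F (\<lambda>\<omega>'. \<forall>j\<in>J. Z j \<omega>' \<in> A j) \<omega> = (\<Prod>j\<in>J. measure (law (B \<omega>)) (A j))"
proof -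
  let ?P = "PiM I (\<lambda>_. L)"
  define E where "E = {p \<in> space (S \<Otimes>\<^sub>M ?P). \<forall>j\<in>J. h (fst p) (snd p j) \<in> A j}"
  have "{p \<in> space (S \<Otimes>\<^sub>M ?P). h (fst p) (snd p j) \<in> A j} \<in> sets (S \<Otimes>\<^sub>M ?P)" if "j \<in> J" for j
  proof -
    have [measurable]: "A j \<in> sets borel" "j \<in> I" using that A J by auto
    show ?thesis by measurable
  qed
  then have E: "E \<in> sets (S \<Otimes>\<^sub>M ?P)"
    unfolding E_def using J by (intro sets.sets_Collect_finite_All) auto
  have V: "(\<lambda>i\<in>I. W i \<omega>) \<in> space ?P" if "\<omega> \<in> space M" for \<omega>
    using that by (auto simp: space_PiM PiE_iff intro: measurable_space[OF W_measurable])
  have Bsp: "B \<omega> \<in> space S" if "\<omega> \<in> space M" for \<omega>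
    using B_measurable that by (rule measurable_space)
  have eq: "((B \<omega>, \<lambda>i\<in>I. W i \<omega>') \<in> E) = (\<forall>j\<in>J. h (B \<omega>) (W j \<omega>') \<in> A j)"
    if "\<omega> \<in> space M" "\<omega>' \<in> space M" for \<omega> \<omega>'
    using that V[of \<omega>'] Bsp[of \<omega>] J by (auto simp: E_def space_pair_measure subset_eq)
  have "alg_cond_prob M F (\<lambda>\<omega>. (B \<omega>, \<lambda>i\<in>I. W i \<omega>) \<in> E) = alg_cond_prob M F (\<lambda>\<omega>'. \<forall>j\<in>J. Z j \<omega>' \<in> A j)"
    unfolding alg_cond_prob_def using eq by (metis (mono_tags, lifting) Collect_cong)
  moreover have "prob {\<omega>' \<in> space M. (B \<omega>, \<lambda>i\<in>I. W i \<omega>') \<in> E} = (\<Prod>j\<in>J. measure (law (B \<omega>)) (A j))"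
    if \<omega>: "\<omega> \<in> space M" for \<omega>
  \<comment> \<open>For empty \<open>J\<close> the intersection used below would be the whole type
    instead of \<open>space M\<close>.\<close>
  proof (cases "J = {}")
    case True
    then show ?thesis using eq[OF \<omega>] by (simp add: prob_space cong: conj_cong)
  next
    case False
    have "{\<omega>' \<in> space M. (B \<omega>, \<lambda>i\<in>I. W i \<omega>') \<in> E} = (\<Inter>j\<in>J. frozen (B \<omega>) j -` A j \<inter> space M)"
      using eq[OF \<omega>] False by auto
    also have "prob \<dots> = (\<Prod>j\<in>J. prob (frozen (B \<omega>) j -` A j \<inter> space M))"
      using frozen_indep[OF Bsp[OF \<omega>]] False J A by (intro indep_varsD) auto
    also have "\<dots> = (\<Prod>j\<in>J. measure (law (B \<omega>)) (A j))"
    proof (rule prod.cong[OF refl])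
      fix j assume j: "j \<in> J"
      then have "j \<in> I" using J by auto
      show "prob (frozen (B \<omega>) j -` A j \<inter> space M) = measure (law (B \<omega>)) (A j)"
        unfolding frozen_distr[OF Bsp[OF \<omega>] \<open>j \<in> I\<close>, symmetric]
        using A[OF j] frozen_measurable[OF Bsp[OF \<omega>] \<open>j \<in> I\<close>] by (simp add: measure_distr)
    qed
    finally show ?thesis .
  qed
  ultimately show ?thesis
    using alg_cond_prob_indep_rvs[OF B_W E] by (auto elim!: AE_mp intro!: AE_I2)
qed

lemma alg_cond_prob_Z_single:
  assumes "i \<in> I" "A \<in> sets borel"
  shows "AE \<omega> in M. alg_cond_prob M F (\<lambda>\<omega>'. Z i \<omega>' \<in> A) \<omega> = measure (law (B \<omega>)) A"
  using alg_cond_prob_Z[of "{i}" "\<lambda>_. A"] assms by simp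

text \<open>Joint and single conditional probabilities are both expressed through
  \<open>law (B \<omega>)\<close>, which does not depend on the index; finiteness of
  \<open>J\<close> merges the null sets.\<close>

lemma cond_iid_Z:
  assumes "K \<subseteq> I"
  shows "cond_iid M F borel Z K"
  unfolding cond_iid_def cond_indep_vars_def
proof (intro conjI ballI allI impI)
  show "Z i \<in> borel_measurable M" if "i \<in> K" for i using that assms by (auto intro: Z_measurable)
next
  fix J A assume J: "J \<subseteq> K" "finite J" and A: "\<forall>j\<in>J. A j \<in> sets (borel :: real measure)"
  have "AE \<omega> in M. \<forall>j\<in>J. alg_cond_prob M F (\<lambda>\<omega>'. Z j \<omega>' \<in> A j) \<omega> = measure (law (B \<omega>)) (A j)"
    using J A assms by (intro AE_finite_allI alg_cond_prob_Z_single) auto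
  moreover have "AE \<omega> in M. alg_cond_prob M F (\<lambda>\<omega>'. \<forall>j\<in>J. Z j \<omega>' \<in> A j) \<omega>
      = (\<Prod>j\<in>J. measure (law (B \<omega>)) (A j))"
    using J A assms by (intro alg_cond_prob_Z) auto
  ultimately show "AE \<omega> in M. alg_cond_prob M F (\<lambda>\<omega>'. \<forall>j\<in>J. Z j \<omega>' \<in> A j) \<omega>
      = (\<Prod>j\<in>J. alg_cond_prob M F (\<lambda>\<omega>'. Z j \<omega>' \<in> A j) \<omega>)"
    by eventually_elim simp
next
  fix i j A assume "i \<in> K" "j \<in> K" "A \<in> sets (borel :: real measure)"
  then have "AE \<omega> in M. alg_cond_prob M F (\<lambda>\<omega>'. Z i \<omega>' \<in> A) \<omega> = measure (law (B \<omega>)) A"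
    and "AE \<omega> in M. alg_cond_prob M F (\<lambda>\<omega>'. Z j \<omega>' \<in> A) \<omega> = measure (law (B \<omega>)) A"
    using assms by (auto intro!: alg_cond_prob_Z_single)
  then show "AE \<omega> in M. alg_cond_prob M F (\<lambda>\<omega>'. Z i \<omega>' \<in> A) \<omega> = alg_cond_prob M F (\<lambda>\<omega>'. Z j \<omega>' \<in> A) \<omega>"
    by eventually_elim simp
qed

text \<open>Exhibits a concrete version, through which the conditional variance becomes the variance
  of \<open>law (B \<omega>)\<close>.\<close>

lemma is_cond_distr_Z:
  assumes i: "i \<in> I"
  shows "is_cond_distr M F borel (Z i) (\<lambda>\<omega>. law (B \<omega>))"
  unfolding is_cond_distr_def
proof (intro conjI ballI)
  have "prob_space D" unfolding W_distr[OF i, symmetric] using i by (intro prob_space_distr) simp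
  moreover have "sets D = sets L" unfolding W_distr[OF i, symmetric] by simp
  ultimately have "D \<in> space (prob_algebra L)" by (simp add: space_prob_algebra)
  then have D: "(\<lambda>_. D) \<in> F \<rightarrow>\<^sub>M prob_algebra L" by simp
  have [measurable]: "B \<in> measurable F S" by (rule measurable_generated_algebra) simp
  show "(\<lambda>\<omega>. law (B \<omega>)) \<in> F \<rightarrow>\<^sub>M prob_algebra borel"
    by (rule measurable_distr_prob_space2[OF D]) measurable
  show "AE \<omega> in M. measure (law (B \<omega>)) A = alg_cond_prob M F (\<lambda>\<omega>'. Z i \<omega>' \<in> A) \<omega>"
    if "A \<in> sets borel" for A
    using alg_cond_prob_Z_single[OF i that] by eventually_elim simp
qed

lemma cond_variance_Z:
  assumes "i \<in> I"
  shows "AE \<omega> in M. cond_variance M F (Z i) \<omega> = distr_variance (law (B \<omega>))"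
  by (rule cond_variance_eq[OF _ is_cond_distr_Z[OF assms]]) simp

end

lemma weak_conv_m_cal_statistic_mixture:
  assumes loc: "iid_with_independent_parameter M {1..} L W D S B h"
    and conv: "AE \<omega> in M.
      weak_conv_m (\<lambda>n. distr M borel (cal_statistic c (\<lambda>i \<omega>'. h (B \<omega>) (W i \<omega>')) n)) \<nu>"
  shows "weak_conv_m (\<lambda>n. distr M borel (cal_statistic c (\<lambda>i \<omega>. h (B \<omega>) (W i \<omega>)) n)) \<nu>"
proof -
  interpret iid_with_independent_parameter M "{1..}" L W D S B h by (rule loc)
  let ?P = "PiM {1..} (\<lambda>_::nat. L)" and ?V = "\<lambda>\<omega>. \<lambda>i\<in>{1..}. W i \<omega>"
  \<comment> \<open>The statistic as one measurable function of parameter and data sequence;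
    freezing the parameter means fixing its first argument.\<close>
  define G where "G n = cal_statistic c (\<lambda>i p. h (fst p) (snd p i)) n" for n
  have [measurable]: "G n \<in> borel_measurable (S \<Otimes>\<^sub>M ?P)" for n
    unfolding G_def
  proof (rule borel_measurable_cal_statistic)
    fix i :: nat assume "i \<ge> 1"
    then have [measurable]: "i \<in> {1..}" by simp
    show "(\<lambda>p. h (fst p) (snd p i)) \<in> borel_measurable (S \<Otimes>\<^sub>M ?P)" by measurable
  qed
  have G: "G n (b, ?V \<omega>) = cal_statistic c (frozen b) n \<omega>"
    "G n (B \<omega>, ?V \<omega>) = cal_statistic c Z n \<omega>" for n b \<omega>
    unfolding G_def by (auto intro!: cal_statistic_cong)
  have V: "?V \<in> measurable M ?P" using B_W by (simp add: indep_rvs_def)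
  have Bsp: "B \<omega> \<in> space S" if "\<omega> \<in> space M" for \<omega>
    using B_measurable that by (rule measurable_space)
  have stat_meas: "cal_statistic c (frozen b) n \<in> borel_measurable M" if "b \<in> space S" for b n
    by (rule borel_measurable_cal_statistic) (use frozen_measurable[OF that] in auto)
  have Z_meas: "cal_statistic c Z n \<in> borel_measurable M" for n
    by (rule borel_measurable_cal_statistic) (use Z_measurable in auto)
  define E where "E n x = {p \<in> space (S \<Otimes>\<^sub>M ?P). G n p \<le> x}" for n x
  have E: "E n x \<in> sets (S \<Otimes>\<^sub>M ?P)" for n x unfolding E_def by measurable
  have in_E: "((b, ?V \<omega>) \<in> E n x) = (G n (b, ?V \<omega>) \<le> x)" if "b \<in> space S" "\<omega> \<in> space M" for b \<omega> n x
    using that measurable_space[OF V] by (simp add: E_def space_pair_measure)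
  define k where "k n x b = prob {\<omega>' \<in> space M. (b, ?V \<omega>') \<in> E n x}" for n x b
  note sec = prob_section_indep_rvs[OF B_W E, folded k_def]
  have cdf_distr: "cdf (distr M borel f) x = prob {\<omega> \<in> space M. f \<omega> \<le> x}"
    if "f \<in> borel_measurable M" for f x
    using that by (simp add: cdf_def measure_distr vimage_def Int_def conj_commute)
  have k: "cdf (distr M borel (cal_statistic c (frozen b) n)) x = k n x b" if "b \<in> space S" for b n x
    unfolding cdf_distr[OF stat_meas[OF that]] k_def
    by (intro arg_cong[where f=prob] Collect_cong conj_cong refl) (simp only: in_E[OF that] G)
  show ?thesis
  proof (rule weak_conv_m_mixture[OF Z_meas _ _ _ conv])
    show "real_distribution (distr M borel (cal_statistic c (frozen (B \<omega>)) n))" if "\<omega> \<in> space M" for n \<omega>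
      by (intro real_distribution_distr stat_meas Bsp that)
    show "(\<lambda>\<omega>. cdf (distr M borel (cal_statistic c (frozen (B \<omega>)) n)) x) \<in> borel_measurable M" for n x
      using measurable_compose[OF B_measurable sec(1)]
      by (rule measurable_cong[THEN iffD2, rotated]) (simp add: k Bsp)
    fix n x
    have "cdf (distr M borel (cal_statistic c Z n)) x = prob {\<omega> \<in> space M. (B \<omega>, ?V \<omega>) \<in> E n x}"
      unfolding cdf_distr[OF Z_meas]
      by (intro arg_cong[where f=prob] Collect_cong conj_cong refl) (simp only: in_E[OF Bsp] G(2))
    also have "\<dots> = expectation (\<lambda>\<omega>. k n x (B \<omega>))" by (rule sec)
    also have "\<dots> = expectation (\<lambda>\<omega>. cdf (distr M borel (cal_statistic c (frozen (B \<omega>)) n)) x)"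
      by (rule Bochner_Integration.integral_cong) (simp_all add: k Bsp)
    finally show "cdf (distr M borel (cal_statistic c Z n)) x
      = expectation (\<lambda>\<omega>. cdf (distr M borel (cal_statistic c (frozen (B \<omega>)) n)) x)" .
  qed
qed

section \<open>Application to weighted residuals under calibration\<close>

theorem proposition3p1:
  fixes M :: "'a measure" and N :: "'x measure"
    and Y0 :: "'a \<Rightarrow> real" and X0 :: "'a \<Rightarrow> 'x"
    and Y :: "nat \<Rightarrow> 'a \<Rightarrow> real" and X :: "nat \<Rightarrow> 'a \<Rightarrow> 'x"
    and J :: "'b set" and YB :: "'b \<Rightarrow> 'a \<Rightarrow> real" and XB :: "'b \<Rightarrow> 'a \<Rightarrow> 'x"
    and B :: "'a \<Rightarrow> 'b \<Rightarrow> real \<times> 'x" and F :: "'a measure"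
    and \<mu> :: "'x \<Rightarrow> real" and g :: "('b \<Rightarrow> real \<times> 'x) \<Rightarrow> 'x \<Rightarrow> real"
    and Z :: "nat \<Rightarrow> 'a \<Rightarrow> real" and c :: real
  defines "B \<equiv> data_vec J YB XB"
    and "F \<equiv> generated_algebra M (data_space J N) B"
    and "Z \<equiv> weighted_residual \<mu> g B Y X"
  assumes "prob_space M"
    and Y0: "Y0 \<in> borel_measurable M" "integrable M (\<lambda>\<omega>. (Y0 \<omega>)\<^sup>2)"
    and X0: "X0 \<in> measurable M N"
    and test_indep: "prob_space.indep_vars M (\<lambda>_. borel \<Otimes>\<^sub>M N) (\<lambda>i \<omega>. (Y i \<omega>, X i \<omega>)) {1..}"
    and test_distr: "\<And>i. i \<ge> 1 \<Longrightarrow>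
      distr M (borel \<Otimes>\<^sub>M N) (\<lambda>\<omega>. (Y i \<omega>, X i \<omega>)) = distr M (borel \<Otimes>\<^sub>M N) (\<lambda>\<omega>. (Y0 \<omega>, X0 \<omega>))"
    and "finite J"
    and batch_indep: "prob_space.indep_vars M (\<lambda>_. borel \<Otimes>\<^sub>M N) (\<lambda>j \<omega>. (YB j \<omega>, XB j \<omega>)) J"
    and batch_distr: "\<And>j k. j \<in> J \<Longrightarrow> k \<in> J \<Longrightarrow>
      distr M (borel \<Otimes>\<^sub>M N) (\<lambda>\<omega>. (YB j \<omega>, XB j \<omega>)) = distr M (borel \<Otimes>\<^sub>M N) (\<lambda>\<omega>. (YB k \<omega>, XB k \<omega>))"
    and batch_test: "indep_rvs M
      (data_space J N) B (data_space {1..} N) (data_vec {1..} Y X)"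
    and pair_test: "indep_rvs M
      (borel \<Otimes>\<^sub>M N) (\<lambda>\<omega>. (Y0 \<omega>, X0 \<omega>)) (data_space {1..} N) (data_vec {1..} Y X)"
    and pair_batch: "indep_rvs M
      (borel \<Otimes>\<^sub>M N) (\<lambda>\<omega>. (Y0 \<omega>, X0 \<omega>)) (data_space J N) B"
    and \<mu>: "\<mu> \<in> borel_measurable N"
    and g: "(\<lambda>(b, x). g b x) \<in> borel_measurable (data_space J N \<Otimes>\<^sub>M N)"
  shows "(\<forall>n\<ge>2. cond_iid M F borel Z {1..n}) \<and>
    ((\<forall>i\<ge>1. AE \<omega> in M. 0 < cond_variance M F (Z i) \<omega> \<and> cond_variance M F (Z i) \<omega> < \<infinity>) \<longrightarrow>
     calibrated M N Y0 X0 \<mu> \<longrightarrow>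
     weak_conv_m (\<lambda>n. distr M borel (cal_statistic c Z n)) std_normal_distribution)"
proof -
  interpret prob_space M by fact
  define h where "h b w = (fst w - \<mu> (snd w)) * g b (snd w)" for b and w :: "real \<times> 'x"
  define W where "W i \<omega> = (Y i \<omega>, X i \<omega>)" for i \<omega>
  let ?L = "borel \<Otimes>\<^sub>M N :: (real \<times> 'x) measure"
  define D where "D = distr M ?L (\<lambda>\<omega>. (Y0 \<omega>, X0 \<omega>))"
  note [measurable] = Y0(1) X0 \<mu>
  have g'[measurable (raw)]: "(\<lambda>x. g (p x) (q x)) \<in> borel_measurable K"
    if "p \<in> measurable K (data_space J N)" "q \<in> measurable K N" for p q and K :: "'k measure"
    using measurable_compose[OF measurable_Pair[OF that] g] by simp
  have "(\<lambda>(b, w). h b w) \<in> borel_measurable (data_space J N \<Otimes>\<^sub>M ?L)"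
    unfolding h_def split_beta' using g'[of "fst" _ "\<lambda>p. snd (snd p)"] by measurable
  then have loc: "iid_with_independent_parameter M {1..} ?L W D (data_space J N) B h"
    using test_indep test_distr batch_test
    by unfold_locales (auto simp: W_def[abs_def] D_def data_vec_def[abs_def])
  interpret L: iid_with_independent_parameter M "{1..}" ?L W D "data_space J N" B h by (rule loc)
  have Z: "Z = (\<lambda>i \<omega>. h (B \<omega>) (W i \<omega>))"
    by (simp add: Z_def weighted_residual_def fun_eq_iff h_def W_def)
  have F: "F = generated_algebra M (data_space J N) B" by (simp add: F_def)
  have Bsp: "B \<omega> \<in> space (data_space J N)" if "\<omega> \<in> space M" for \<omega>
    using L.B_measurable that by (rule measurable_space)
  have clt: "weak_conv_m (\<lambda>n. distr M borel (cal_statistic c (\<lambda>i \<omega>. h b (W i \<omega>)) n)) std_normal_distribution"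
    if cal: "calibrated M N Y0 X0 \<mu>" and b: "b \<in> space (data_space J N)"
      and var: "0 < distr_variance (L.law b)" "distr_variance (L.law b) < \<infinity>" for b
  proof -
    have [measurable]: "g b \<in> borel_measurable N" using measurable_Pair2[OF g b] by simp
    note [measurable] = L.h_section[OF b]
    have "real_distribution (L.law b)"
      using L.frozen_distr[OF b, of 1] L.frozen_measurable[OF b, of 1] real_distribution_distr by fastforce
    then interpret nu: real_distribution "L.law b" .
    note int = nu.distr_variance_finite[OF var(2)]
    have law: "L.law b = distr M borel (\<lambda>\<omega>. (Y0 \<omega> - \<mu> (X0 \<omega>)) * g b (X0 \<omega>))"
      unfolding D_def by (subst distr_distr) (auto simp: comp_def h_def)
    have "integrable M (\<lambda>\<omega>. (Y0 \<omega> - \<mu> (X0 \<omega>)) * g b (X0 \<omega>))"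
      using int(2) unfolding law by (subst (asm) integrable_distr_eq) auto
    moreover have "integrable M Y0" by (rule square_integrable_imp_integrable[OF Y0])
    ultimately have "expectation (\<lambda>\<omega>. (Y0 \<omega> - \<mu> (X0 \<omega>)) * g b (X0 \<omega>)) = 0"
      by (intro calibrated_orthogonal[OF _ _ _ _ cal]) auto
    then have mean: "(\<integral>x. x \<partial>L.law b) = 0"
      unfolding law by (subst integral_distr) auto
    \<comment> \<open>As the mean is 0, the variance is the second moment, whose positivity the
      central limit theorem requires.\<close>
    have "distr_variance (L.law b) = ennreal (\<integral>x. x\<^sup>2 \<partial>L.law b)"
      unfolding distr_variance_def mean using int(1) by (simp add: nn_integral_eq_integral)
    then have "0 < (\<integral>x. x\<^sup>2 \<partial>L.law b)" using var(1) by simp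
    then show ?thesis
      using L.frozen_distr[OF b]
      by (intro cal_statistic_central_limit[where \<nu>="L.law b"] L.frozen_indep[OF b] int(1) mean) auto
  qed
  show ?thesis
  proof (intro conjI allI impI)
    show "cond_iid M F borel Z {1..n}" for n unfolding Z F by (rule L.cond_iid_Z) auto
  next
    assume var: "\<forall>i\<ge>1. AE \<omega> in M. 0 < cond_variance M F (Z i) \<omega> \<and> cond_variance M F (Z i) \<omega> < \<infinity>"
      and cal: "calibrated M N Y0 X0 \<mu>"
    \<comment> \<open>Index 1 represents the whole sequence: all \<open>Z i\<close> share the
      conditional law \<open>L.law (B \<omega>)\<close>.\<close>
    have "AE \<omega> in M. cond_variance M F (Z 1) \<omega> = distr_variance (L.law (B \<omega>))"
      unfolding Z F by (rule L.cond_variance_Z) simp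
    moreover have "AE \<omega> in M. 0 < cond_variance M F (Z 1) \<omega> \<and> cond_variance M F (Z 1) \<omega> < \<infinity>"
      using var by simp
    ultimately have "AE \<omega> in M.
        weak_conv_m (\<lambda>n. distr M borel (cal_statistic c (\<lambda>i \<omega>'. h (B \<omega>) (W i \<omega>')) n)) std_normal_distribution"
      using AE_space
    proof eventually_elim
      case (elim \<omega>)
      then show ?case by (intro clt[OF cal Bsp]) auto
    qed
    then show "weak_conv_m (\<lambda>n. distr M borel (cal_statistic c Z n)) std_normal_distribution"
      unfolding Z by (rule weak_conv_m_cal_statistic_mixture[OF loc])
  qed
qed

end
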